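(* Let $P$ be the set of shallow permutations and let $$G(x)=\sum_{n=0}^\infty\ \sum_{w\in P\cap S_n} x^n \in \mathbb{Z}[[x]]$$ be the generating function counting shallow permutations. Then $G=G(x)$ satisfies $$x^2G^3 + (x^2 - 3x + 1)G^2 + (3x-2)G + 1 =0.$$
   Context: $S_n$ is the group of permutations of $\{1,\ldots,n\}$; $S_0$ consists of the single empty permutation, which is counted as shallow, so the constant term of $G$ is $1$. Thus the coefficient of $x^n$ in $G$ is the number of shallow permutations in $S_n$. For $w\in S_n$: - the length $\ell(w)$ is the smallest integer $\ell$ such that $w$ is a product of $\ell$ adjacent transpositions $s_i=(i\ \ i+1)$; equivalently, it is the number of pairs $(a,b)$ with $a<b$ and $w(a)>w(b)$; - the reflection length $\ell_T(w)$ is the smallest integer $r$ such that $w$ is a product of $r$ transpositions $t_{ij}=(i\ \ j)$; equivalently, $\ell_T(w)=n-\operatorname{cyc}(w)$, where $\operatorname{cyc}(w)$ is the number of cycles in the cycle decomposition of $w$ (fixed points included); - the total displacement is $\operatorname{td}(w)=\sum_{i=1}^n |w(i)-i|$. One always has $\ell(w)+\ell_T(w)\leq \operatorname{td}(w)$. The permutation $w$ is called shallow if $\ell(w)+\ell_T(w)=\operatorname{td}(w)$. *)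

theory Defs
  imports
    "HOL-Combinatorics.Permutations"
    "HOL-Computational_Algebra.Formal_Power_Series"
begin

text \<open>
  \<open>S\<^sub>n\<close> is the set of functions \<open>w :: nat \<Rightarrow> nat\<close> with \<open>w permutes {1..n}\<close>; such functions
  fix every number outside \<open>{1..n}\<close>, so that \<open>S\<^sub>0 = {id}\<close>.
\<close>

definition adjacent_transpositions :: "nat \<Rightarrow> (nat \<Rightarrow> nat) set" where
  "adjacent_transpositions n = {transpose i (i + 1) | i. 1 \<le> i \<and> i + 1 \<le> n}"

definition transpositions :: "nat \<Rightarrow> (nat \<Rightarrow> nat) set" where
  "transpositions n = {transpose i j | i j. 1 \<le> i \<and> i < j \<and> j \<le> n}"

text \<open>
  The least number of factors in an expression of \<open>w\<close> as a product of elements of \<open>T\<close>.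
  It is meaningful only if such an expression exists (\<open>LEAST\<close> over an empty range is
  unspecified); for the two generating sets above this is the case for every \<open>w \<in> S\<^sub>n\<close>.
\<close>

definition word_length :: "('a \<Rightarrow> 'a) set \<Rightarrow> ('a \<Rightarrow> 'a) \<Rightarrow> nat" where
  "word_length T w = (LEAST k. \<exists>ts. length ts = k \<and> set ts \<subseteq> T \<and> w = foldr (\<circ>) ts id)"

definition perm_length :: "nat \<Rightarrow> (nat \<Rightarrow> nat) \<Rightarrow> nat" where
  "perm_length n w = word_length (adjacent_transpositions n) w"

definition reflection_length :: "nat \<Rightarrow> (nat \<Rightarrow> nat) \<Rightarrow> nat" where
  "reflection_length n w = word_length (transpositions n) w"

definition total_displacement :: "nat \<Rightarrow> (nat \<Rightarrow> nat) \<Rightarrow> int" where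
  "total_displacement n w = (\<Sum>i = 1..n. \<bar>int (w i) - int i\<bar>)"

definition shallow :: "nat \<Rightarrow> (nat \<Rightarrow> nat) \<Rightarrow> bool" where
  "shallow n w \<longleftrightarrow>
     int (perm_length n w) + int (reflection_length n w) = total_displacement n w"

definition shallow_perms :: "nat \<Rightarrow> (nat \<Rightarrow> nat) set" where
  "shallow_perms n = {w. w permutes {1..n} \<and> shallow n w}"

definition shallow_gf :: "int fps" where
  "shallow_gf = Abs_fps (\<lambda>n. int (card (shallow_perms n)))"

end

theory Submission
  imports Defs
begin

text \<open>
  Let \<open>v\<close> permute \<open>{1..n}\<close>, let \<open>j \<le> n\<close>, and let \<open>w = v \<circ> (j n+1)\<close>. The defect
  \<open>td - \<ell> - \<ell>\<^sub>T\<close> of \<open>w\<close> exceeds that of \<open>v\<close> by \<open>2 min(A, B)\<close>, where \<open>A\<close> counts the smaller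
  entries of \<open>v\<close> to the right of \<open>j\<close> and \<open>B\<close> the greater ones to the left. So the defect is
  nonnegative, and the shallow permutations form a tree: the children of a shallow \<open>v\<close> are \<open>v\<close>
  itself, with \<open>n + 1\<close> added as a fixed point, and the \<open>w\<close> for which \<open>j\<close> is the position of a
  left-to-right maximum or of a right-to-left minimum (an extreme position).

  Let \<open>v\<close> have \<open>k\<close> blocks (direct summands) and \<open>e\<close> extreme positions. By avoidance of 3412 among
  the extreme entries, the numbers of extreme positions of the children coming from one block of
  \<open>m\<close> extreme positions, preceded by \<open>r\<close> others, are \<open>r + 3, ..., r + m + 1, r + m + 1\<close>
  (only \<open>r + 2\<close> if \<open>m = 1\<close>). Hence, if \<open>y\<close> is the power series in \<open>x\<close> with
  \<open>x (1 + 2y) (1 + 3y + y\<^sup>2) = y (1 + y)\<close>, the descendants of \<open>v\<close> are counted by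
  \<open>G \<tau>\<^sup>k z\<^sup>e\<close> with \<open>z = 1 + y\<close>, \<open>\<tau> = (1 + 2y) / z\<^sup>2\<close> and \<open>G = 1 + y / z\<^sup>2\<close>. The tree starts at
  the empty permutation, so \<open>G\<close> is the generating function, and eliminating \<open>y\<close> gives the cubic.
\<close>

section \<open>Words\<close>

definition word_prod :: "('a \<Rightarrow> 'a) list \<Rightarrow> 'a \<Rightarrow> 'a" where
  "word_prod ts = foldr (\<circ>) ts id"

lemma word_prod_Nil: "word_prod [] = id"
  by (simp add: word_prod_def)

lemma word_prod_Cons: "word_prod (t # ts) = t \<circ> word_prod ts"
  by (simp add: word_prod_def)

lemma word_prod_append: "word_prod (xs @ ys) = word_prod xs \<circ> word_prod ys"
  by (induction xs) (simp_all add: word_prod_def comp_assoc)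

lemma word_length_eqI:
  assumes "set ts \<subseteq> T" and "w = word_prod ts" and "length ts = k"
    and "\<And>us. set us \<subseteq> T \<Longrightarrow> w = word_prod us \<Longrightarrow> k \<le> length us"
  shows "word_length T w = k"
  unfolding word_length_def word_prod_def[symmetric]
proof (rule Least_equality)
  show "\<exists>ts. length ts = k \<and> set ts \<subseteq> T \<and> w = word_prod ts"
    using assms(1-3) by blast
next
  fix y assume "\<exists>ts. length ts = y \<and> set ts \<subseteq> T \<and> w = word_prod ts"
  then show "k \<le> y" using assms(4) by blast
qed

lemma word_length_le: "set ts \<subseteq> T \<Longrightarrow> word_length T (word_prod ts) \<le> length ts"
  unfolding word_length_def word_prod_def[symmetric] by (rule Least_le) blast

text \<open>The word \<open>us\<close> ensures that the \<open>LEAST\<close> in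
  \<open>word_length\<close> ranges over a nonempty set and is therefore attained.\<close>

lemma word_lengthE:
  assumes "set us \<subseteq> T" and "w = word_prod us"
  obtains ts where "set ts \<subseteq> T" "w = word_prod ts" "length ts = word_length T w"
proof -
  have "\<exists>k ts. length ts = k \<and> set ts \<subseteq> T \<and> w = word_prod ts"
    using assms by blast
  from LeastI_ex[OF this] show ?thesis
    using that unfolding word_length_def word_prod_def[symmetric] by blast
qed

section \<open>Length and inversions\<close>

definition inversions :: "nat \<Rightarrow> (nat \<Rightarrow> nat) \<Rightarrow> (nat \<times> nat) set" where
  "inversions n w = {(a, b). 1 \<le> a \<and> a < b \<and> b \<le> n \<and> w b < w a}"

lemma finite_inversions [simp]: "finite (inversions n w)"
  by (rule finite_subset[of _ "{1..n} \<times> {1..n}"]) (auto simp: inversions_def)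

lemma inversions_id [simp]: "inversions n id = {}"
  by (auto simp: inversions_def)

lemma inj_permutes_eq: "w permutes S \<Longrightarrow> w a = w b \<longleftrightarrow> a = b"
  by (meson injD permutes_inj)

text \<open>No number lies strictly between \<open>i\<close> and \<open>Suc i\<close>, so exchanging
  them affects only the comparison of these two.\<close>

lemma transpose_Suc_less_iff:
  assumes "x \<noteq> y" "{x, y} \<noteq> {i, Suc i}"
  shows "transpose i (Suc i) x < transpose i (Suc i) y \<longleftrightarrow> x < y"
  using assms by (auto simp: transpose_def)

text \<open>Multiplying by \<open>t\<close> on the left exchanges two neighbouring values, so the
  pair of their positions \<open>p\<close> and \<open>q\<close> is the only one that can become an
  inversion.\<close>

lemma inversions_adjacent_step:
  assumes "w permutes {1..n}" "t \<in> adjacent_transpositions n"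
  shows "card (inversions n (t \<circ> w)) \<le> Suc (card (inversions n w))"
proof -
  obtain i where i: "1 \<le> i" "i + 1 \<le> n" "t = transpose i (Suc i)"
    using assms(2) by (auto simp: adjacent_transpositions_def)
  define p where "p = inv w i"
  define q where "q = inv w (Suc i)"
  have wpq: "w p = i" "w q = Suc i"
    using assms(1) by (simp_all add: p_def q_def permutes_inverses)
  have inj: "w a = w b \<longleftrightarrow> a = b" for a b
    by (rule inj_permutes_eq[OF assms(1)])
  have "inversions n (t \<circ> w) \<subseteq> insert (min p q, max p q) (inversions n w)"
  proof (rule subrelI)
    fix a b assume ab: "(a, b) \<in> inversions n (t \<circ> w)"
    show "(a, b) \<in> insert (min p q, max p q) (inversions n w)"
    proof (cases "{w b, w a} = {i, Suc i}")
      case True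
      then have "{b, a} = {p, q}" using wpq inj by (metis doubleton_eq_iff)
      then show ?thesis using ab by (auto simp: inversions_def doubleton_eq_iff)
    next
      case False
      have "a \<noteq> b" using ab by (auto simp: inversions_def)
      then show ?thesis using ab False transpose_Suc_less_iff[of "w b" "w a" i] inj i(3)
        by (auto simp: inversions_def)
    qed
  qed
  then have "card (inversions n (t \<circ> w)) \<le> card (insert (min p q, max p q) (inversions n w))"
    by (intro card_mono) auto
  also have "\<dots> \<le> Suc (card (inversions n w))" by (simp add: card_insert_if)
  finally show ?thesis .
qed

lemma adjacent_transpositions_permute: "t \<in> adjacent_transpositions n \<Longrightarrow> t permutes {1..n}"
  by (auto simp: adjacent_transpositions_def intro!: permutes_swap_id)

lemma word_prod_permutes: "(\<And>t. t \<in> set ts \<Longrightarrow> t permutes S) \<Longrightarrow> word_prod ts permutes S"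
proof (induction ts)
  case (Cons t ts)
  then show ?case using permutes_compose[of "word_prod ts" S t] by (auto simp: word_prod_Cons o_def)
qed (simp add: permutes_id word_prod_Nil)

lemma card_inversions_word_prod_le:
  "set ts \<subseteq> adjacent_transpositions n \<Longrightarrow> card (inversions n (word_prod ts)) \<le> length ts"
proof (induction ts)
  case Nil
  have "inversions n (word_prod []) = {}" by (simp only: word_prod_Nil inversions_id)
  then show ?case by simp
next
  case (Cons t ts)
  have "word_prod ts permutes {1..n}"
    using Cons.prems by (intro word_prod_permutes adjacent_transpositions_permute) auto
  from inversions_adjacent_step[OF this, of t] Cons.prems
  have "card (inversions n (word_prod (t # ts))) \<le> Suc (card (inversions n (word_prod ts)))"
    unfolding word_prod_Cons by force
  also have "\<dots> \<le> length (t # ts)" using Cons by force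
  finally show ?case .
qed

lemma strict_mono_permutes_id:
  assumes "w permutes {1..n::nat}" "\<And>a b. a < b \<Longrightarrow> b \<le> n \<Longrightarrow> 1 \<le> a \<Longrightarrow> w a < w b"
  shows "w = id"
proof -
  have ge: "a \<le> w a" for a
  proof (induction a)
    case (Suc a)
    show ?case
    proof (cases "1 \<le> a \<and> Suc a \<le> n")
      case True
      with assms(2)[of a "Suc a"] Suc show ?thesis by simp
    next
      case False
      then show ?thesis
        using permutes_in_image[OF assms(1), of "Suc a"] permutes_not_in[OF assms(1), of "Suc a"]
        by (cases "Suc a \<le> n") auto
    qed
  qed simp
  have inj: "w a = w b \<longleftrightarrow> a = b" for a b
    by (rule inj_permutes_eq[OF assms(1)])
  \<comment> \<open>From the top down: a value of \<open>w (n - d)\<close> above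
    \<open>n - d\<close> would be a fixed point by induction, against injectivity.\<close>
  have "w (n - d) = n - d" for d
  proof (induction d rule: less_induct)
    case (less d)
    show ?case
    proof (rule ccontr)
      assume ne: "w (n - d) \<noteq> n - d"
      then have "n - d \<in> {1..n}" using permutes_not_in[OF assms(1)] by blast
      then have "w (n - d) \<le> n" "d \<le> n" using permutes_in_image[OF assms(1), of "n-d"] by auto
      moreover have "w (n - d) > n - d" using ge[of "n - d"] ne by simp
      ultimately have "w (n - d) = n - (n - w (n - d))" "n - w (n - d) < d" by auto
      then have "w (w (n - d)) = w (n - d)" using less[of "n - w (n - d)"] by simp
      then show False using inj ne by simp
    qed
  qed
  then have "w a = a" for a
    by (metis assms(1) atLeastAtMost_iff diff_diff_cancel permutes_not_in)
  then show ?thesis by auto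
qed

text \<open>Otherwise the positions of the values \<open>1, ..., n\<close> increase with the value,
  and there is no inversion.\<close>

lemma exists_descending_adjacent:
  assumes w: "w permutes {1..n}" and ne: "inversions n w \<noteq> {}"
  obtains i where "1 \<le> i" "Suc i \<le> n" "inv w (Suc i) < inv w i"
proof (rule ccontr)
  assume "\<not> thesis"
  with that have *: "inv w i \<le> inv w (Suc i)" if "1 \<le> i" "Suc i \<le> n" for i
    using that linorder_not_less by metis
  have "inv w i \<le> inv w k" if "1 \<le> i" "i \<le> k" "k \<le> n" for i k
    using that(2,3)
  proof (induction k rule: dec_induct)
    case (step m)
    then show ?case using *[of m] that(1) by auto
  qed simp
  note mono = this
  obtain a b where ab: "1 \<le> a" "a < b" "b \<le> n" "w b < w a"
    using ne by (auto simp: inversions_def)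
  have "w a \<in> {1..n}" "w b \<in> {1..n}"
    using ab permutes_in_image[OF w, of a] permutes_in_image[OF w, of b] by auto
  then have "inv w (w b) \<le> inv w (w a)" using ab mono[of "w b" "w a"] by auto
  then show False using ab(2) by (simp add: permutes_inverses[OF w])
qed

lemma adjacent_word_exists:
  assumes "w permutes {1..n}"
  shows "\<exists>ts. set ts \<subseteq> adjacent_transpositions n \<and> w = word_prod ts
    \<and> length ts = card (inversions n w)"
  using assms
proof (induction "card (inversions n w)" arbitrary: w)
  case 0
  then have "inversions n w = {}" by simp
  then have "w a < w b" if "a < b" "b \<le> n" "1 \<le> a" for a b
    using that inj_permutes_eq[OF 0(2), of a b]
    by (auto simp: inversions_def) (meson linorder_neqE_nat)
  with 0 have "w = id" by (intro strict_mono_permutes_id) auto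
  then have "w = word_prod []" by (simp only: word_prod_Nil)
  then show ?case using \<open>inversions n w = {}\<close> by (intro exI[of _ "[]"]) simp
next
  case (Suc k)
  note w = Suc.prems
  have "inversions n w \<noteq> {}" using Suc.hyps(2) by auto
  from exists_descending_adjacent[OF w this] obtain i where
    i: "1 \<le> i" "Suc i \<le> n" "inv w (Suc i) < inv w i" .
  define t where "t = transpose i (Suc i)"
  have t: "t \<in> adjacent_transpositions n" using i by (auto simp: adjacent_transpositions_def t_def)
  define p where "p = inv w (Suc i)"
  define q where "q = inv w i"
  have wpq: "w p = Suc i" "w q = i"
    using w by (simp_all add: p_def q_def permutes_inverses)
  have pq: "p < q" using i by (simp add: p_def q_def)
  have inj: "w a = w b \<longleftrightarrow> a = b" for a b
    by (rule inj_permutes_eq[OF w])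
  have tw: "t \<circ> w permutes {1..n}"
    using adjacent_transpositions_permute[OF t] w by (simp add: permutes_compose)
  have "p \<in> {1..n}" "q \<in> {1..n}"
    using permutes_in_image[OF w, of p] permutes_in_image[OF w, of q] wpq i by auto
  then have mem: "(p, q) \<in> inversions n w" using wpq pq by (auto simp: inversions_def)
  have "inversions n (t \<circ> w) \<subseteq> inversions n w - {(p, q)}"
  proof (rule subrelI)
    fix a b assume ab: "(a, b) \<in> inversions n (t \<circ> w)"
    show "(a, b) \<in> inversions n w - {(p, q)}"
    proof (cases "{w b, w a} = {i, Suc i}")
      case True
      then have "{b, a} = {p, q}" using wpq inj by (metis doubleton_eq_iff)
      with pq ab have "a = p \<and> b = q" by (auto simp: inversions_def doubleton_eq_iff)
      then show ?thesis using ab wpq by (auto simp: inversions_def t_def)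
    next
      case False
      have "a \<noteq> b" using ab by (auto simp: inversions_def)
      then show ?thesis using ab False transpose_Suc_less_iff[of "w b" "w a" i] inj wpq
        by (auto simp: inversions_def t_def)
    qed
  qed
  then have "card (inversions n (t \<circ> w)) \<le> card (inversions n w - {(p, q)})"
    by (intro card_mono) auto
  also have "\<dots> = k" using mem Suc.hyps(2) by simp
  finally have le: "card (inversions n (t \<circ> w)) \<le> k" .
  have inv_t: "t \<circ> (t \<circ> w) = w" by (simp add: t_def flip: comp_assoc)
  \<comment> \<open>\<open>t\<close> is an involution, so the one-step bound applied to
    \<open>t \<circ> w\<close> shows that only one inversion was lost.\<close>
  have "Suc k \<le> Suc (card (inversions n (t \<circ> w)))"
    using inversions_adjacent_step[OF tw t] Suc.hyps(2) inv_t by simp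
  with le have "k = card (inversions n (t \<circ> w))" by simp
  from Suc.hyps(1)[OF this tw] obtain ts where
    ts: "set ts \<subseteq> adjacent_transpositions n" "t \<circ> w = word_prod ts" "length ts = k"
    using \<open>k = _\<close> by auto
  then have "w = word_prod (t # ts)" using inv_t unfolding word_prod_Cons by simp
  then show ?case using ts t Suc.hyps(2) by (intro exI[of _ "t # ts"]) auto
qed

lemma perm_length_eq_card_inversions:
  assumes "w permutes {1..n}"
  shows "perm_length n w = card (inversions n w)"
proof -
  from adjacent_word_exists[OF assms] obtain ts where
    "set ts \<subseteq> adjacent_transpositions n" "w = word_prod ts"
    "length ts = card (inversions n w)" by blast
  then show ?thesis
    unfolding perm_length_def
    by (rule word_length_eqI) (use card_inversions_word_prod_le in blast)
qed

section \<open>Reflection length\<close>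

lemma transpositions_permute: "t \<in> transpositions n \<Longrightarrow> t permutes {1..n}"
  by (auto simp: transpositions_def intro!: permutes_swap_id)

lemma transpose_in_transpositions:
  assumes "a \<in> {1..n}" "b \<in> {1..n}" "a \<noteq> b"
  shows "transpose a b \<in> transpositions n"
proof (cases "a < b")
  case True
  then show ?thesis using assms by (auto simp: transpositions_def)
next
  case False
  then have "transpose a b = transpose b a" "b < a" using assms by (auto simp: transpose_commute)
  then show ?thesis using assms unfolding transpositions_def by auto
qed

lemma transpositions_mono: "transpositions n \<subseteq> transpositions (Suc n)"
  by (fastforce simp: transpositions_def)

lemma transpositions_SucE:
  assumes "t \<in> transpositions (Suc n)"
  obtains "t \<in> transpositions n" | b where "b \<in> {1..n}" "t = transpose b (Suc n)"
proof -
  from assms obtain i j where ij: "1 \<le> i" "i < j" "j \<le> Suc n" "t = transpose i j"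
    by (auto simp: transpositions_def)
  show ?thesis
  proof (cases "j = Suc n")
    case True
    then show ?thesis using ij by (intro that(2)[of i]) auto
  next
    case False
    then have "j \<le> n" using ij by simp
    then show ?thesis using ij by (intro that(1)) (unfold transpositions_def, blast)
  qed
qed

lemma word_prod_transpositions_permutes: "set ts \<subseteq> transpositions n \<Longrightarrow> word_prod ts permutes {1..n}"
  by (intro word_prod_permutes transpositions_permute) auto

text \<open>This replaces two factors moving \<open>m\<close> by a single one, standing at the
  right.\<close>

lemma transpose_comp_transpose:
  "c \<noteq> a \<Longrightarrow> c \<noteq> m \<Longrightarrow> a \<noteq> m \<Longrightarrow> transpose c m \<circ> transpose a m = transpose c a \<circ> transpose c m"
  by (auto simp: transpose_def fun_eq_iff)

text \<open>
  All factors moving \<open>n + 1\<close> can be pushed to the right end of a word and merged into at most one,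
  without making the word longer.
\<close>

lemma transposition_word_normal_form:
  assumes "set ts \<subseteq> transpositions (Suc n)"
  shows "(\<exists>us. set us \<subseteq> transpositions n \<and> word_prod ts = word_prod us \<and> length us \<le> length ts) \<or>
    (\<exists>us. \<exists>a\<in>{1..n}. set us \<subseteq> transpositions n \<and>
       word_prod ts = word_prod us \<circ> transpose a (Suc n) \<and> length us < length ts)"
    (is "?A ts \<or> ?B ts")
  using assms
proof (induction ts)
  case Nil
  have "?A []" by (intro exI[of _ "[]"]) simp
  then show ?case ..
next
  case (Cons t ts)
  let ?m = "Suc n"
  have t: "t \<in> transpositions ?m" and "set ts \<subseteq> transpositions ?m"
    using Cons.prems by auto
  then consider "?A ts" | "?B ts" using Cons.IH by blast
  then show ?case
  proof cases
    case 1
    then obtain us where us: "set us \<subseteq> transpositions n" "word_prod ts = word_prod us"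
      "length us \<le> length ts" by blast
    note P = word_prod_transpositions_permutes[OF us(1)]
    from t show ?thesis
    proof (cases rule: transpositions_SucE)
      case 1
      then have "?A (t # ts)"
        using us by (intro exI[of _ "t # us"]) (auto simp: word_prod_Cons)
      then show ?thesis ..
    next
      case (2 b)
      \<comment> \<open>Moving \<open>t\<close> to the right past \<open>word_prod us\<close>
        conjugates it. The product fixes \<open>Suc n\<close>, so only \<open>b\<close> changes, to
        its preimage \<open>c\<close>.\<close>
      define c where "c = inv (word_prod us) b"
      have c: "c \<in> {1..n}" using permutes_in_image[OF permutes_inv[OF P], of b] 2 by (simp add: c_def)
      have m: "inv (word_prod us) ?m = ?m" using permutes_not_in[OF permutes_inv[OF P]] by simp
      have "word_prod (t # ts) = word_prod us \<circ> transpose c ?m"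
        using transpose_comp_eq[OF permutes_bij[OF P], of b ?m] us 2
        by (simp add: word_prod_Cons c_def m)
      then have "?B (t # ts)" using us c by (intro exI[of _ us] bexI[of _ c]) auto
      then show ?thesis ..
    qed
  next
    case 2
    then obtain us a where us: "set us \<subseteq> transpositions n" "a \<in> {1..n}"
      "word_prod ts = word_prod us \<circ> transpose a ?m" "length us < length ts" by blast
    note P = word_prod_transpositions_permutes[OF us(1)]
    from t show ?thesis
    proof (cases rule: transpositions_SucE)
      case 1
      then have "?B (t # ts)"
        using us by (intro exI[of _ "t # us"] bexI[of _ a]) (auto simp: word_prod_Cons comp_assoc)
      then show ?thesis ..
    next
      case (2 b)
      define c where "c = inv (word_prod us) b"
      have c: "c \<in> {1..n}" using permutes_in_image[OF permutes_inv[OF P], of b] 2 by (simp add: c_def)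
      have m: "inv (word_prod us) ?m = ?m" using permutes_not_in[OF permutes_inv[OF P]] by simp
      have "word_prod (t # ts) = (t \<circ> word_prod us) \<circ> transpose a ?m"
        by (simp only: word_prod_Cons us(3) comp_assoc)
      also have "t \<circ> word_prod us = word_prod us \<circ> transpose c ?m"
        using transpose_comp_eq[OF permutes_bij[OF P], of b ?m] 2 by (simp add: c_def m)
      finally have eq: "word_prod (t # ts) = word_prod us \<circ> (transpose c ?m \<circ> transpose a ?m)"
        by (simp only: comp_assoc)
      show ?thesis
      proof (cases "c = a")
        case True
        then have "word_prod (t # ts) = word_prod us" using eq by simp
        then have "?A (t # ts)" using us by (intro exI[of _ us]) auto
        then show ?thesis ..
      next
        case False
        then have "word_prod (t # ts) = word_prod us \<circ> (transpose c a \<circ> transpose c ?m)"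
          using transpose_comp_transpose[of c a ?m] c us eq by simp
        then have "word_prod (t # ts) = word_prod (us @ [transpose c a]) \<circ> transpose c ?m"
          by (simp add: word_prod_append word_prod_Cons word_prod_Nil comp_assoc)
        moreover have "transpose c a \<in> transpositions n"
          using transpose_in_transpositions False c us by blast
        ultimately have "?B (t # ts)" using us c
          by (intro exI[of _ "us @ [transpose c a]"] bexI[of _ c]) auto
        then show ?thesis ..
      qed
    qed
  qed
qed

lemma permutes_transpose_last:
  assumes "w permutes {1..Suc n}" "w j = Suc n"
  shows "w \<circ> transpose j (Suc n) permutes {1..n}"
proof (rule permutes_superset[of _ "{1..Suc n}"])
  have "j \<in> {1..Suc n}" using assms permutes_in_image[OF assms(1), of j] by simp
  then show "w \<circ> transpose j (Suc n) permutes {1..Suc n}"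
    using assms(1) by (intro permutes_compose permutes_swap_id) auto
next
  fix x assume "x \<in> {1..Suc n} - {1..n}"
  then have "x = Suc n" by auto
  then show "(w \<circ> transpose j (Suc n)) x = x" using assms by simp
qed

lemma transposition_word_exists:
  "w permutes {1..n} \<Longrightarrow> \<exists>ts. set ts \<subseteq> transpositions n \<and> w = word_prod ts"
proof (induction n arbitrary: w)
  case 0
  then have "w = word_prod []" by (simp add: word_prod_Nil)
  then show ?case by (intro exI[of _ "[]"]) simp
next
  case (Suc n)
  define j where "j = inv w (Suc n)"
  have wj: "w j = Suc n" using Suc.prems by (simp add: j_def permutes_inverses)
  then have j: "j \<in> {1..Suc n}" using permutes_in_image[OF Suc.prems, of j] by simp
  from Suc.IH[OF permutes_transpose_last[OF Suc.prems wj]] obtain ts where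
    ts: "set ts \<subseteq> transpositions n" "w \<circ> transpose j (Suc n) = word_prod ts" by blast
  have w: "w = word_prod ts \<circ> transpose j (Suc n)"
    by (simp add: comp_assoc flip: ts(2))
  show ?case
  proof (cases "j = Suc n")
    case True
    then show ?thesis using w ts transpositions_mono by auto
  next
    case False
    then have "w = word_prod (ts @ [transpose j (Suc n)])"
      using w by (simp add: word_prod_append word_prod_Cons word_prod_Nil)
    moreover have "transpose j (Suc n) \<in> transpositions (Suc n)"
      using j False by (intro transpose_in_transpositions) auto
    ultimately show ?thesis
      using ts transpositions_mono[of n] by (intro exI[of _ "ts @ [transpose j (Suc n)]"]) auto
  qed
qed

lemma reflection_length_word:
  assumes "v permutes {1..n}"
  obtains ts where "set ts \<subseteq> transpositions n" "v = word_prod ts" "length ts = reflection_length n v"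
proof -
  obtain us where "set us \<subseteq> transpositions n" "v = word_prod us"
    using transposition_word_exists[OF assms] by blast
  from word_lengthE[OF this] show ?thesis using that unfolding reflection_length_def by metis
qed

text \<open>Factors moving \<open>Suc n\<close> cannot shorten a word for \<open>v\<close>: if one
  survived in the normal form, \<open>v\<close> would send \<open>Suc n\<close> into
  \<open>{1..n}\<close>.\<close>

lemma reflection_length_Suc_fixed:
  assumes v: "v permutes {1..n}"
  shows "reflection_length (Suc n) v = reflection_length n v"
proof -
  obtain ts where ts: "set ts \<subseteq> transpositions n" "v = word_prod ts" "length ts = reflection_length n v"
    using reflection_length_word[OF v] .
  show ?thesis
    unfolding reflection_length_def[of "Suc n"]
  proof (rule word_length_eqI)
    show "set ts \<subseteq> transpositions (Suc n)" using ts transpositions_mono by blast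
  next
    fix us assume us: "set us \<subseteq> transpositions (Suc n)" "v = word_prod us"
    have vm: "v (Suc n) = Suc n" using permutes_not_in[OF v] by simp
    from transposition_word_normal_form[OF us(1)]
    show "reflection_length n v \<le> length us"
    proof (elim disjE exE bexE conjE)
      fix us' assume us': "set us' \<subseteq> transpositions n" "word_prod us = word_prod us'"
        "length us' \<le> length us"
      then show ?thesis using word_length_le[OF us'(1)] us by (simp add: reflection_length_def)
    next
      fix us' a assume us': "set us' \<subseteq> transpositions n" "a \<in> {1..n}"
        "word_prod us = word_prod us' \<circ> transpose a (Suc n)"
      then have "v (Suc n) = word_prod us' a" using us by simp
      then have "v (Suc n) \<in> {1..n}"
        using us' permutes_in_image[OF word_prod_transpositions_permutes[OF us'(1)], of a] by simp
      then show ?thesis using vm by simp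
    qed
  qed (use ts in auto)
qed

text \<open>The permutation moves \<open>Suc n\<close>, so the normal form of any word for it ends
  in a factor moving \<open>Suc n\<close>. This factor must be \<open>transpose j (Suc n)\<close>,
  and cancelling it leaves a strictly shorter word for \<open>v\<close>.\<close>

lemma reflection_length_Suc_transpose:
  assumes v: "v permutes {1..n}" and j: "j \<in> {1..n}"
  shows "reflection_length (Suc n) (v \<circ> transpose j (Suc n)) = Suc (reflection_length n v)"
proof -
  obtain ts where ts: "set ts \<subseteq> transpositions n" "v = word_prod ts" "length ts = reflection_length n v"
    using reflection_length_word[OF v] .
  have vm: "v (Suc n) = Suc n" using permutes_not_in[OF v] by simp
  show ?thesis
    unfolding reflection_length_def[of "Suc n"]
  proof (rule word_length_eqI)
    show "set (ts @ [transpose j (Suc n)]) \<subseteq> transpositions (Suc n)"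
      using ts transpositions_mono[of n] transpose_in_transpositions[of j "Suc n" "Suc n"] j by auto
    show "v \<circ> transpose j (Suc n) = word_prod (ts @ [transpose j (Suc n)])"
      using ts by (simp add: word_prod_append word_prod_Cons word_prod_Nil)
  next
    fix us assume us: "set us \<subseteq> transpositions (Suc n)" "v \<circ> transpose j (Suc n) = word_prod us"
    from transposition_word_normal_form[OF us(1)]
    show "Suc (reflection_length n v) \<le> length us"
    proof (elim disjE exE bexE conjE)
      fix us' assume us': "set us' \<subseteq> transpositions n" "word_prod us = word_prod us'"
      have "word_prod us (Suc n) = v j" using us(2) by (metis comp_apply transpose_apply_second)
      moreover have "word_prod us (Suc n) = Suc n"
        using permutes_not_in[OF word_prod_transpositions_permutes[OF us'(1)], of "Suc n"] us' by simp
      moreover have "v j \<in> {1..n}" using permutes_in_image[OF v, of j] j by simp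
      ultimately show ?thesis by simp
    next
      fix us' a assume us': "set us' \<subseteq> transpositions n" "a \<in> {1..n}"
        "word_prod us = word_prod us' \<circ> transpose a (Suc n)" "length us' < length us"
      have "word_prod us a = Suc n"
        using permutes_not_in[OF word_prod_transpositions_permutes[OF us'(1)], of "Suc n"] us' by simp
      then have "v (transpose j (Suc n) a) = v (Suc n)" using us(2) vm by (metis comp_apply)
      then have "transpose j (Suc n) a = Suc n" using inj_permutes_eq[OF v] by blast
      then have "a = j" using us'(2) by (auto simp: transpose_def split: if_splits)
      then have "v \<circ> transpose j (Suc n) \<circ> transpose j (Suc n) = word_prod us' \<circ> transpose j (Suc n) \<circ> transpose j (Suc n)"
        using us us' by simp
      then have "v = word_prod us'" by (simp add: comp_assoc)
      then show ?thesis using us' word_length_le[OF us'(1)] by (simp add: reflection_length_def)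
    qed
  qed (use ts in auto)
qed

section \<open>The defect\<close>

definition defect :: "nat \<Rightarrow> (nat \<Rightarrow> nat) \<Rightarrow> int" where
  "defect n w = total_displacement n w - int (perm_length n w) - int (reflection_length n w)"

lemma shallow_iff_defect: "shallow n w \<longleftrightarrow> defect n w = 0"
  by (auto simp: shallow_def defect_def)

text \<open>The size of this set is the number \<open>A\<close>, and that of
  \<open>left_greater v j\<close> the number \<open>B\<close>, in the change of the defect.\<close>

definition right_smaller :: "nat \<Rightarrow> (nat \<Rightarrow> nat) \<Rightarrow> nat \<Rightarrow> nat set" where
  "right_smaller n v j = {i. j < i \<and> i \<le> n \<and> v i < v j}"

definition left_greater :: "(nat \<Rightarrow> nat) \<Rightarrow> nat \<Rightarrow> nat set" where
  "left_greater v j = {i. 1 \<le> i \<and> i < j \<and> v j < v i}"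

lemma finite_right_smaller [simp]: "finite (right_smaller n v j)"
  by (rule finite_subset[of _ "{1..n}"]) (auto simp: right_smaller_def)

lemma finite_left_greater [simp]: "finite (left_greater v j)"
  by (rule finite_subset[of _ "{1..j}"]) (auto simp: left_greater_def)

lemma inversions_Suc_fixed:
  assumes "v permutes {1..n}"
  shows "inversions (Suc n) v = inversions n v"
proof -
  have "\<not> v (Suc n) < v a" if "1 \<le> a" "a < Suc n" for a
    using that permutes_in_image[OF assms, of a] permutes_not_in[OF assms, of "Suc n"] by simp
  then show ?thesis by (auto simp: inversions_def le_Suc_eq)
qed

lemma card_values_greater:
  assumes "v permutes {1..n}" "j \<in> {1..n}"
  shows "card {i \<in> {1..n}. v j < v i} = n - v j"
proof -
  have "v ` {i \<in> {1..n}. v j < v i} = {v j <.. n}"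
  proof (intro equalityI subsetI)
    fix y assume "y \<in> {v j<..n}"
    then have "v (inv v y) = y" "y \<in> {1..n}" by (auto simp: permutes_inverses[OF assms(1)])
    moreover then have "inv v y \<in> {1..n}"
      using permutes_in_image[OF assms(1), of "inv v y"] by simp
    ultimately show "y \<in> v ` {i \<in> {1..n}. v j < v i}"
      using \<open>y \<in> {v j<..n}\<close> by (intro image_eqI[of _ _ "inv v y"]) auto
  qed (use permutes_in_image[OF assms(1)] in force)
  moreover have "inj_on v {i \<in> {1..n}. v j < v i}"
    using permutes_inj_on[OF assms(1)] by (rule inj_on_subset) auto
  ultimately show ?thesis by (metis card_image card_greaterThanAtMost)
qed

text \<open>Count the entries smaller than \<open>v j\<close>: there are \<open>v j - 1\<close> of
  them, \<open>A\<close> to the right of \<open>j\<close> and \<open>j - 1 - B\<close> to the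
  left.\<close>

lemma card_right_smaller_left_greater:
  assumes v: "v permutes {1..n}" and j: "j \<in> {1..n}"
  shows "card (right_smaller n v j) + j = card (left_greater v j) + v j"
proof -
  let ?L = "{i. 1 \<le> i \<and> i < j \<and> v i < v j}"
  have inj: "v a = v b \<longleftrightarrow> a = b" for a b by (rule inj_permutes_eq[OF v])
  have vj: "v j \<in> {1..n}" using j permutes_in_image[OF v, of j] by simp
  have "card {1..n} = card ({i \<in> {1..n}. v j < v i} \<union> ({i \<in> {1..n}. v i < v j} \<union> {j}))"
    using j inj by (intro arg_cong[where f = card]) (auto, metis linorder_neqE_nat)
  also have "\<dots> = card {i \<in> {1..n}. v j < v i} + (card {i \<in> {1..n}. v i < v j} + 1)"
    by (subst card_Un_disjoint; auto)+
  finally have 1: "card {i \<in> {1..n}. v i < v j} + 1 = v j"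
    using card_values_greater[OF v j] vj by simp arith
  have "{i \<in> {1..n}. v i < v j} = right_smaller n v j \<union> ?L"
    using j by (auto simp: right_smaller_def) (metis linorder_neqE_nat order_less_irrefl)
  moreover have "right_smaller n v j \<inter> ?L = {}" by (auto simp: right_smaller_def)
  moreover have fin: "finite ?L" by (rule finite_subset[of _ "{1..n}"]) (use j in auto)
  ultimately have 2: "card {i \<in> {1..n}. v i < v j} = card (right_smaller n v j) + card ?L"
    by (simp add: card_Un_disjoint)
  have "{1..<j} = left_greater v j \<union> ?L"
    using inj by (auto simp: left_greater_def) (metis linorder_neqE_nat order_less_irrefl)
  moreover have "left_greater v j \<inter> ?L = {}" by (auto simp: left_greater_def)
  ultimately have "card {1..<j} = card (left_greater v j) + card ?L"
    using fin by (simp add: card_Un_disjoint)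
  then show ?thesis using 1 2 j by simp arith
qed

text \<open>Inversions not involving position \<open>j\<close> form the common part
  \<open>I\<close>. In \<open>v\<close> the position \<open>j\<close> adds \<open>A + B\<close>
  more. In \<open>w\<close> the entry \<open>Suc n\<close> at \<open>j\<close> is inverted with the
  \<open>n + 1 - j\<close> later positions, and \<open>v j\<close> at the end with the
  \<open>n - v j\<close> greater entries of \<open>v\<close>.\<close>

lemma card_inversions_Suc_transpose:
  assumes v: "v permutes {1..n}" and j: "j \<in> {1..n}"
  defines "w \<equiv> v \<circ> transpose j (Suc n)"
  shows "int (card (inversions (Suc n) w)) = int (card (inversions n v)) + 2 * int n + 1
    - int j - int (v j) - int (card (right_smaller n v j)) - int (card (left_greater v j))"
proof -
  define I where "I = {(a, b) \<in> inversions n v. a \<noteq> j \<and> b \<noteq> j}"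
  let ?R = "right_smaller n v j" and ?L = "left_greater v j"
  let ?C = "{i \<in> {1..n}. v j < v i}"
  have vj: "v j \<in> {1..n}" using j permutes_in_image[OF v, of j] by simp
  have w: "w j = Suc n" "w (Suc n) = v j" "\<And>i. i \<noteq> j \<Longrightarrow> i \<noteq> Suc n \<Longrightarrow> w i = v i"
    using permutes_not_in[OF v] by (auto simp: w_def)
  have vn: "v i \<le> n" if "1 \<le> i" "i \<le> n" for i
    using permutes_in_image[OF v, of i] that by auto
  have [simp]: "finite I" by (rule finite_subset[of _ "inversions n v"]) (auto simp: I_def)
  have "inversions n v = I \<union> (Pair j ` ?R \<union> (\<lambda>i. (i, j)) ` ?L)"
    using j by (auto simp: I_def inversions_def right_smaller_def left_greater_def)
  then have "card (inversions n v) = card (I \<union> (Pair j ` ?R \<union> (\<lambda>i. (i, j)) ` ?L))" by simp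
  also have "\<dots> = card I + (card (Pair j ` ?R) + card ((\<lambda>i. (i, j)) ` ?L))"
  proof (subst card_Un_disjoint)
    show "I \<inter> (Pair j ` ?R \<union> (\<lambda>i. (i, j)) ` ?L) = {}"
      by (auto simp: I_def)
    show "card I + card (Pair j ` ?R \<union> (\<lambda>i. (i, j)) ` ?L) =
        card I + (card (Pair j ` ?R) + card ((\<lambda>i. (i, j)) ` ?L))"
      by (subst card_Un_disjoint) (auto simp: right_smaller_def)
  qed auto
  also have "\<dots> = card I + (card ?R + card ?L)"
    by (simp add: card_image inj_on_def)
  finally have 1: "card (inversions n v) = card I + (card ?R + card ?L)" .
  have "(a, b) \<in> inversions (Suc n) w \<longleftrightarrow> (a, b) \<in> I \<union> (Pair j ` {Suc j..Suc n} \<union> (\<lambda>i. (i, Suc n)) ` ?C)"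
    for a b
  proof (cases "1 \<le> a \<and> a < b \<and> b \<le> Suc n")
    case True
    consider "a = j" | "a \<noteq> j" "b = Suc n" | "b = j" | "a \<noteq> j" "b \<noteq> j" "b \<noteq> Suc n" by blast
    then show ?thesis
    proof cases
      case 1
      then have "w b < w a" using True w vn[of b] vj by (cases "b = Suc n") auto
      then show ?thesis using 1 True by (auto simp: inversions_def)
    next
      case 2
      then show ?thesis using True w j by (auto simp: inversions_def I_def)
    next
      case 3
      then show ?thesis using True w j vn[of a] by (auto simp: inversions_def I_def)
    next
      case 4
      then show ?thesis using True w j by (auto simp: inversions_def I_def)
    qed
  next
    case False
    then show ?thesis using j by (auto simp: inversions_def I_def)
  qed
  then have "inversions (Suc n) w = I \<union> (Pair j ` {Suc j..Suc n} \<union> (\<lambda>i. (i, Suc n)) ` ?C)" by auto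
  then have "card (inversions (Suc n) w) = card (I \<union> (Pair j ` {Suc j..Suc n} \<union> (\<lambda>i. (i, Suc n)) ` ?C))"
    by simp
  also have "\<dots> = card I + (card (Pair j ` {Suc j..Suc n}) + card ((\<lambda>i. (i, Suc n)) ` ?C))"
  proof (subst card_Un_disjoint)
    show "I \<inter> (Pair j ` {Suc j..Suc n} \<union> (\<lambda>i. (i, Suc n)) ` ?C) = {}"
      by (auto simp: I_def inversions_def)
    show "card I + card (Pair j ` {Suc j..Suc n} \<union> (\<lambda>i. (i, Suc n)) ` ?C) =
        card I + (card (Pair j ` {Suc j..Suc n}) + card ((\<lambda>i. (i, Suc n)) ` ?C))"
      by (subst card_Un_disjoint) auto
  qed auto
  also have "\<dots> = card I + (Suc n - j + (n - v j))"
    by (simp add: card_image inj_on_def card_values_greater[OF v j, simplified])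
  finally show ?thesis using 1 j vj by simp
qed

lemma total_displacement_Suc_fixed:
  assumes "v permutes {1..n}"
  shows "total_displacement (Suc n) v = total_displacement n v"
  using permutes_not_in[OF assms, of "Suc n"] by (simp add: total_displacement_def)

text \<open>The terms \<open>n + 1 - j\<close> and \<open>n + 1 - v j\<close> replace the absolute
  value of \<open>v j - j\<close>; the other terms stay.\<close>

lemma total_displacement_Suc_transpose:
  assumes v: "v permutes {1..n}" and j: "j \<in> {1..n}"
  shows "total_displacement (Suc n) (v \<circ> transpose j (Suc n)) =
    total_displacement n v + 2 * (int (Suc n) - int (max (v j) j))"
proof -
  let ?w = "v \<circ> transpose j (Suc n)"
  have vj: "v j \<in> {1..n}" using j permutes_in_image[OF v, of j] by simp
  have vm: "v (Suc n) = Suc n" using permutes_not_in[OF v] by simp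
  have "(\<Sum>i\<in>{1..n} - {j}. \<bar>int (?w i) - int i\<bar>) = (\<Sum>i\<in>{1..n} - {j}. \<bar>int (v i) - int i\<bar>)"
    by (intro sum.cong) auto
  moreover have "(\<Sum>i\<in>{1..n}. \<bar>int (?w i) - int i\<bar>) =
      \<bar>int (?w j) - int j\<bar> + (\<Sum>i\<in>{1..n} - {j}. \<bar>int (?w i) - int i\<bar>)"
    using j by (intro sum.remove) auto
  moreover have "total_displacement n v = \<bar>int (v j) - int j\<bar> + (\<Sum>i\<in>{1..n} - {j}. \<bar>int (v i) - int i\<bar>)"
    unfolding total_displacement_def using j by (intro sum.remove) auto
  moreover have "total_displacement (Suc n) ?w =
      (\<Sum>i\<in>{1..n}. \<bar>int (?w i) - int i\<bar>) + \<bar>int (?w (Suc n)) - int (Suc n)\<bar>"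
    by (simp add: total_displacement_def)
  ultimately show ?thesis using j vj vm by (auto simp: max_def)
qed

lemma permutes_Suc_fixed: "v permutes {1..n} \<Longrightarrow> v permutes {1..Suc n}"
  by (rule permutes_subset) auto

lemma permutes_Suc_transpose:
  "v permutes {1..n} \<Longrightarrow> j \<in> {1..n} \<Longrightarrow> v \<circ> transpose j (Suc n) permutes {1..Suc n}"
  by (intro permutes_compose permutes_swap_id permutes_Suc_fixed) auto

lemma defect_Suc_fixed:
  assumes "v permutes {1..n}"
  shows "defect (Suc n) v = defect n v"
  using assms permutes_Suc_fixed[OF assms]
  by (simp add: defect_def total_displacement_Suc_fixed reflection_length_Suc_fixed
      perm_length_eq_card_inversions inversions_Suc_fixed)

text \<open>The three changes add up to \<open>A + B\<close> minus the absolute value of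
  \<open>v j - j\<close>, which equals \<open>A - B\<close> by the count above.\<close>

lemma defect_Suc_transpose:
  assumes v: "v permutes {1..n}" and j: "j \<in> {1..n}"
  shows "defect (Suc n) (v \<circ> transpose j (Suc n)) =
    defect n v + 2 * int (min (card (right_smaller n v j)) (card (left_greater v j)))"
  using card_right_smaller_left_greater[OF v j]
    card_inversions_Suc_transpose[OF v j] total_displacement_Suc_transpose[OF v j]
    reflection_length_Suc_transpose[OF v j]
    perm_length_eq_card_inversions[OF v] perm_length_eq_card_inversions[OF permutes_Suc_transpose[OF v j]]
  unfolding defect_def by (simp add: min_def max_def split: if_splits)

section \<open>The tree of shallow permutations\<close>

lemma permutes_Suc_cases [consumes 1, case_names fixed moved]:
  assumes "w permutes {1..Suc n}"
  obtains "w permutes {1..n}"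
    | v j where "v permutes {1..n}" "j \<in> {1..n}" "w = v \<circ> transpose j (Suc n)"
proof -
  define j where "j = inv w (Suc n)"
  have wj: "w j = Suc n" using assms by (simp add: j_def permutes_inverses)
  then have j: "j \<in> {1..Suc n}" using permutes_in_image[OF assms, of j] by simp
  note v = permutes_transpose_last[OF assms wj]
  show ?thesis
  proof (cases "j = Suc n")
    case True
    then show ?thesis using v that(1) by simp
  next
    case False
    then show ?thesis using v j that(2)[OF v, of j] by (simp add: comp_assoc)
  qed
qed

lemma defect_0 [simp]: "defect 0 id = 0"
proof -
  have "reflection_length 0 id = 0"
    unfolding reflection_length_def by (rule word_length_eqI[of "[]"]) (simp_all add: word_prod_Nil)
  then show ?thesis
    using perm_length_eq_card_inversions[of id 0] by (simp add: defect_def total_displacement_def)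
qed

text \<open>Both terms of the defect of a child are thus nonnegative, so a shallow child has a
  shallow parent and \<open>min(A, B) = 0\<close>.\<close>

lemma defect_nonneg: "w permutes {1..n} \<Longrightarrow> 0 \<le> defect n w"
proof (induction n arbitrary: w)
  case 0
  then have "w = id" by simp
  then show ?case using defect_0 by (metis order_refl)
next
  case (Suc n)
  from Suc.prems show ?case
  proof (cases rule: permutes_Suc_cases)
    case fixed
    then show ?thesis using defect_Suc_fixed Suc.IH by metis
  next
    case (moved v j)
    have "0 \<le> defect (Suc n) (v \<circ> transpose j (Suc n))"
      using defect_Suc_transpose[OF moved(1,2)] Suc.IH[OF moved(1)] by linarith
    then show ?thesis using moved(3) by metis
  qed
qed

section \<open>Extreme positions and the tree recursion\<close>

text \<open>\<open>i\<close> may be \<open>0\<close> here, and beyond \<open>n\<close> in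
  \<open>rlmin\<close>: a permutation of \<open>{1..n}\<close> fixes these numbers, so they never
  violate the condition for \<open>j\<close> in \<open>{1..n}\<close>. Neither notion depends on
  \<open>n\<close>.\<close>

definition lrmax :: "(nat \<Rightarrow> nat) \<Rightarrow> nat \<Rightarrow> bool" where
  "lrmax v j \<longleftrightarrow> (\<forall>i<j. v i < v j)"

definition rlmin :: "(nat \<Rightarrow> nat) \<Rightarrow> nat \<Rightarrow> bool" where
  "rlmin v j \<longleftrightarrow> (\<forall>i>j. v j < v i)"

definition extremes :: "nat \<Rightarrow> (nat \<Rightarrow> nat) \<Rightarrow> nat set" where
  "extremes n v = {j \<in> {1..n}. lrmax v j \<or> rlmin v j}"

lemma finite_extremes [simp]: "finite (extremes n v)"
  by (simp add: extremes_def)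

lemma permutes_0: "v permutes {1..n::nat} \<Longrightarrow> v 0 = 0"
  by (rule permutes_not_in) auto

lemma permutes_pos: "v permutes {1..n::nat} \<Longrightarrow> 1 \<le> j \<Longrightarrow> 1 \<le> v j"
  using inj_permutes_eq[of v "{1..n}" j 0] permutes_0[of v n] by (cases "v j") auto

lemma permutes_le: "v permutes {1..n::nat} \<Longrightarrow> i \<le> n \<Longrightarrow> v i \<le> n"
  using permutes_in_image[of v "{1..n}" i] permutes_0[of v n] by (cases "i = 0") auto

lemma permutes_gt: "v permutes {1..n::nat} \<Longrightarrow> i > n \<Longrightarrow> v i = i"
  by (rule permutes_not_in) auto

lemma left_greater_empty_iff:
  assumes v: "v permutes {1..n}" and j: "j \<in> {1..n}"
  shows "left_greater v j = {} \<longleftrightarrow> lrmax v j"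
proof -
  have "v i < v j" if "\<And>i. 1 \<le> i \<Longrightarrow> i < j \<Longrightarrow> \<not> v j < v i" "i < j" for i
    using that(1)[of i] that(2) inj_permutes_eq[OF v, of i j] permutes_0[OF v]
      permutes_pos[OF v, of j] j by (cases "i = 0") auto
  then show ?thesis by (force simp: left_greater_def lrmax_def)
qed

lemma right_smaller_empty_iff:
  assumes v: "v permutes {1..n}" and j: "j \<in> {1..n}"
  shows "right_smaller n v j = {} \<longleftrightarrow> rlmin v j"
proof -
  have "v j < v i" if "\<And>i. j < i \<Longrightarrow> i \<le> n \<Longrightarrow> \<not> v i < v j" "j < i" for i
    using that(1)[of i] that(2) inj_permutes_eq[OF v, of i j] permutes_le[OF v, of j]
      permutes_gt[OF v, of i] j by (cases "i \<le> n") auto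
  then show ?thesis by (force simp: right_smaller_def rlmin_def)
qed

lemma shallow_Suc_transpose_iff:
  assumes v: "v permutes {1..n}" and j: "j \<in> {1..n}"
  shows "shallow (Suc n) (v \<circ> transpose j (Suc n)) \<longleftrightarrow> shallow n v \<and> j \<in> extremes n v"
proof -
  have "min (card (right_smaller n v j)) (card (left_greater v j)) = 0 \<longleftrightarrow> j \<in> extremes n v"
    using left_greater_empty_iff[OF v j] right_smaller_empty_iff[OF v j] j
    by (auto simp: min_def extremes_def)
  then show ?thesis
    using defect_nonneg[OF v] by (auto simp: shallow_iff_defect defect_Suc_transpose[OF v j])
qed

lemma shallow_perms_0: "shallow_perms 0 = {id}"
  by (auto simp: shallow_perms_def shallow_iff_defect)

lemma finite_shallow_perms [simp]: "finite (shallow_perms n)"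
  by (rule finite_subset[OF _ finite_permutations[of "{1..n}"]]) (auto simp: shallow_perms_def)

lemma shallow_perms_Suc:
  "shallow_perms (Suc n) = shallow_perms n \<union>
     (\<lambda>(v, j). v \<circ> transpose j (Suc n)) ` (SIGMA v : shallow_perms n. extremes n v)" (is "?A = ?B \<union> ?C")
proof (intro equalityI subsetI)
  fix w assume "w \<in> ?A"
  then have w: "w permutes {1..Suc n}" "shallow (Suc n) w" by (auto simp: shallow_perms_def)
  from w(1) show "w \<in> ?B \<union> ?C"
  proof (cases rule: permutes_Suc_cases)
    case fixed
    then show ?thesis using w by (simp add: shallow_perms_def shallow_iff_defect defect_Suc_fixed)
  next
    case (moved v j)
    then have "v \<in> shallow_perms n \<and> j \<in> extremes n v"
      using w shallow_Suc_transpose_iff[OF moved(1,2)] by (simp add: shallow_perms_def)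
    then show ?thesis using moved(3) by auto
  qed
next
  fix w assume "w \<in> ?B \<union> ?C"
  then show "w \<in> ?A"
  proof
    assume "w \<in> ?B"
    then have "w permutes {1..n}" "defect n w = 0" by (auto simp: shallow_perms_def shallow_iff_defect)
    then show ?thesis
      using permutes_Suc_fixed[of w n]
      by (simp add: shallow_perms_def shallow_iff_defect defect_Suc_fixed del: One_nat_def)
  next
    assume "w \<in> ?C"
    then obtain v j where vj: "v \<in> shallow_perms n" "j \<in> extremes n v" "w = v \<circ> transpose j (Suc n)"
      by auto
    then have "v permutes {1..n}" "j \<in> {1..n}" by (auto simp: shallow_perms_def extremes_def)
    then show ?thesis
      using shallow_Suc_transpose_iff permutes_Suc_transpose vj by (auto simp: shallow_perms_def)
  qed
qed

text \<open>Every node has one parent: \<open>j\<close> is recovered as the position of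
  \<open>Suc n\<close>, then \<open>v\<close> by undoing the transposition. The term
  \<open>h v\<close> belongs to the child that fixes \<open>Suc n\<close>.\<close>

lemma sum_shallow_perms_Suc:
  "(\<Sum>w\<in>shallow_perms (Suc n). h w) =
     (\<Sum>v\<in>shallow_perms n. h v + (\<Sum>j\<in>extremes n v. h (v \<circ> transpose j (Suc n))))"
proof -
  let ?S = "SIGMA v : shallow_perms n. extremes n v"
  let ?g = "\<lambda>(v, j). v \<circ> transpose j (Suc n)"
  have in_S: "v permutes {1..n} \<and> j \<in> {1..n}" if "(v, j) \<in> ?S" for v j
    using that by (auto simp: shallow_perms_def extremes_def)
  have "inj_on ?g ?S"
  proof (rule inj_onI)
    fix x y assume xy: "x \<in> ?S" "y \<in> ?S" "?g x = ?g y"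
    obtain v j v' j' where eq: "x = (v, j)" "y = (v', j')" by (cases x, cases y) blast
    have *: "(v, j) \<in> ?S" "(v', j') \<in> ?S" "v \<circ> transpose j (Suc n) = v' \<circ> transpose j' (Suc n)"
      using xy unfolding eq by auto
    note v = in_S[OF *(1)] in_S[OF *(2)]
    have vm: "v (Suc n) = Suc n" "v' (Suc n) = Suc n" using v by (auto intro: permutes_gt)
    have "v (transpose j (Suc n) j) = v' (transpose j' (Suc n) j)" using *(3) by (metis comp_apply)
    then have "v' (transpose j' (Suc n) j) = v' (Suc n)" using vm by simp
    then have "transpose j' (Suc n) j = Suc n" using v inj_permutes_eq[of v' "{1..n}"] by blast
    then have j: "j = j'" using v by (auto simp: transpose_def split: if_splits)
    have "(v \<circ> transpose j (Suc n)) \<circ> transpose j (Suc n) = (v' \<circ> transpose j (Suc n)) \<circ> transpose j (Suc n)"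
      using * j by simp
    then show "x = y" using j by (simp add: comp_assoc eq)
  qed
  moreover have "shallow_perms n \<inter> ?g ` ?S = {}"
  proof -
    have "(v \<circ> transpose j (Suc n)) (Suc n) \<noteq> Suc n" if "(v, j) \<in> ?S" for v j
      using in_S[OF that] permutes_le[of v n j] by auto
    moreover have "w (Suc n) = Suc n" if "w \<in> shallow_perms n" for w
      using that by (auto simp: shallow_perms_def intro: permutes_gt)
    ultimately show ?thesis by fastforce
  qed
  ultimately have "(\<Sum>w\<in>shallow_perms (Suc n). h w) =
      (\<Sum>w\<in>shallow_perms n. h w) + (\<Sum>x\<in>?S. h (?g x))"
    unfolding shallow_perms_Suc by (subst sum.union_disjoint) (auto simp: sum.reindex)
  also have "(\<Sum>x\<in>?S. h (?g x)) = (\<Sum>v\<in>shallow_perms n. \<Sum>j\<in>extremes n v. h (v \<circ> transpose j (Suc n)))"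
    by (subst sum.Sigma) (auto intro!: sum.cong)
  finally show ?thesis by (simp add: sum.distrib)
qed

section \<open>Extreme positions of the children\<close>

text \<open>The greatest entry \<open>Suc n\<close> now stands at \<open>j\<close> and hides all
  later positions; nothing changes before it.\<close>

lemma lrmax_transpose_iff:
  assumes v: "v permutes {1..n}" and j: "j \<in> {1..n}" and i: "i \<le> Suc n"
  shows "lrmax (v \<circ> transpose j (Suc n)) i \<longleftrightarrow> i = j \<or> i < j \<and> lrmax v i"
proof -
  let ?w = "v \<circ> transpose j (Suc n)"
  have w: "?w j = Suc n" "?w (Suc n) = v j" "\<And>i. i \<noteq> j \<Longrightarrow> i \<noteq> Suc n \<Longrightarrow> ?w i = v i"
    using permutes_gt[OF v] by auto
  have le: "v i \<le> n" if "i \<le> n" for i using permutes_le[OF v that] .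
  consider "i < j" | "i = j" | "j < i" "i \<le> n" | "i = Suc n" using i by linarith
  then show ?thesis
  proof cases
    case 1
    then have "?w k = v k" if "k \<le> i" for k using w(3)[of k] that j by auto
    then show ?thesis using 1 by (auto simp: lrmax_def)
  next
    case 2
    have "?w k < ?w j" if "k < j" for k using that w(1) w(3)[of k] le[of k] j by auto
    then show ?thesis using 2 by (auto simp: lrmax_def)
  next
    case 3
    then have "\<not> ?w j < ?w i" using w(1) w(3)[of i] le[of i] by auto
    then show ?thesis using 3 unfolding lrmax_def by auto
  next
    case 4
    then have "\<not> ?w j < ?w i" "j < i" using w(1,2) le[of j] j by auto
    then have "\<not> lrmax ?w i" unfolding lrmax_def by blast
    then show ?thesis using 4 j by auto
  qed
qed

text \<open>The last entry is now \<open>v j\<close>. It is a right-to-left minimum and rules out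
  all earlier entries that are not smaller.\<close>

lemma rlmin_transpose_iff:
  assumes v: "v permutes {1..n}" and j: "j \<in> {1..n}" and i: "i \<le> Suc n"
  shows "rlmin (v \<circ> transpose j (Suc n)) i \<longleftrightarrow> i = Suc n \<or> i \<le> n \<and> rlmin v i \<and> v i < v j"
proof -
  let ?w = "v \<circ> transpose j (Suc n)"
  have w: "?w j = Suc n" "?w (Suc n) = v j" "\<And>i. i \<noteq> j \<Longrightarrow> i \<noteq> Suc n \<Longrightarrow> ?w i = v i"
    using permutes_gt[OF v] by auto
  have le: "v i \<le> n" if "i \<le> n" for i using permutes_le[OF v that] .
  have gt: "v i = i" if "i > n" for i using permutes_gt[OF v that] .
  consider "i = j" | "i \<noteq> j" "i \<le> n" | "i = Suc n" using i by linarith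
  then show ?thesis
  proof cases
    case 1
    then have "\<not> ?w i < ?w (Suc n)" using w le[of j] j by auto
    moreover have "i < Suc n" using 1 j by auto
    ultimately show ?thesis using 1 j unfolding rlmin_def by auto
  next
    case 2
    have wi: "?w i = v i" using w(3)[of i] 2 by auto
    have "(\<forall>k>i. v i < ?w k) \<longleftrightarrow> (\<forall>k>i. v i < v k) \<and> v i < v j"
    proof (intro iffI conjI allI impI)
      assume *: "\<forall>k>i. v i < ?w k"
      then show vij: "v i < v j" using *[rule_format, of "Suc n"] w(2) 2 by auto
      fix k assume "k > i"
      then show "v i < v k"
        using * w(3)[of k] vij gt[of "Suc n"] le[of i] 2 by (cases "k = j \<or> k = Suc n") auto
    next
      fix k assume *: "(\<forall>k>i. v i < v k) \<and> v i < v j" "k > i"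
      then show "v i < ?w k" using w(1) w(2) w(3)[of k] le[of i] 2
        by (cases "k = j"; cases "k = Suc n") auto
    qed
    then show ?thesis using 2 unfolding rlmin_def wi by auto
  next
    case 3
    have "?w (Suc n) < ?w k" if "Suc n < k" for k
      using that w(2) w(3)[of k] le[of j] gt[of k] j by auto
    then show ?thesis using 3 unfolding rlmin_def by auto
  qed
qed

section \<open>Avoidance of 3412 among the extreme entries\<close>

text \<open>Here \<open>v a < v b\<close> and \<open>v c < v d\<close> hold by extremality, so the
  pattern 3412 would occur exactly if \<open>v d < v a\<close>.\<close>

definition no_extreme_3412 :: "(nat \<Rightarrow> nat) \<Rightarrow> bool" where
  "no_extreme_3412 v \<longleftrightarrow> (\<forall>a b c d. a < b \<longrightarrow> b < c \<longrightarrow> c < d \<longrightarrow>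
     lrmax v a \<longrightarrow> lrmax v b \<longrightarrow> rlmin v c \<longrightarrow> rlmin v d \<longrightarrow> v a \<le> v d)"

text \<open>An occurrence in the child is traced back to \<open>v\<close>. If it uses the new last
  position, whose entry is \<open>v j\<close>, then \<open>j\<close> takes the place of
  \<open>d\<close>; this works because \<open>j\<close> is extreme in \<open>v\<close>.\<close>

lemma no_extreme_3412_transpose:
  assumes v: "v permutes {1..n}" and j: "j \<in> extremes n v" and no: "no_extreme_3412 v"
  shows "no_extreme_3412 (v \<circ> transpose j (Suc n))"
  unfolding no_extreme_3412_def
proof (intro allI impI)
  let ?w = "v \<circ> transpose j (Suc n)"
  fix a b c d assume abcd: "a < b" "b < c" "c < d"
    and ext: "lrmax ?w a" "lrmax ?w b" "rlmin ?w c" "rlmin ?w d"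
  have j1: "j \<in> {1..n}" and jext: "lrmax v j \<or> rlmin v j" using j by (auto simp: extremes_def)
  note w = permutes_Suc_transpose[OF v j1]
  have no': "v a \<le> v d" if "a < b" "b < c" "c < d" "lrmax v a" "lrmax v b" "rlmin v c" "rlmin v d" for a b c d
    using no that unfolding no_extreme_3412_def by blast
  show "?w a \<le> ?w d"
  proof (cases "d \<le> Suc n")
    case False
    then have "?w d = d" using permutes_gt[OF w, of d] by simp
    moreover have "?w a \<le> Suc n \<or> ?w a = a"
      using permutes_le[OF w, of a] permutes_gt[OF w, of a] by linarith
    ultimately show ?thesis using False abcd by linarith
  next
    case True
    have b: "b = j \<or> b < j \<and> lrmax v b" using lrmax_transpose_iff[OF v j1, of b] ext abcd True by auto
    have a: "a < j" "lrmax v a" using lrmax_transpose_iff[OF v j1, of a] ext abcd True b by auto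
    have wa: "?w a = v a" using a j1 by auto
    have c: "c \<le> n" "rlmin v c" "v c < v j" using rlmin_transpose_iff[OF v j1, of c] ext abcd True by auto
    show ?thesis
    proof (cases "d = Suc n")
      case True
      then have wd: "?w d = v j" by simp
      show ?thesis
      proof (cases "lrmax v j")
        case True
        then show ?thesis using a wa wd by (auto simp: lrmax_def intro: less_imp_le)
      next
        case False
        then have "rlmin v j" using jext by simp
        moreover have "c < j" using c \<open>rlmin v j\<close> unfolding rlmin_def
          by (metis less_asym linorder_neqE_nat)
        ultimately show ?thesis using no'[of a b c j] a b c abcd wa wd by auto
      qed
    next
      case False
      then have d: "d \<le> n" "rlmin v d" "v d < v j"
        using rlmin_transpose_iff[OF v j1, of d] ext True by auto
      then have "d \<noteq> j" by auto
      then have wd: "?w d = v d" using d(1) by auto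
      \<comment> \<open>If \<open>b = j\<close>, the smaller entry at \<open>d\<close> behind it
        prevents a right-to-left minimum at \<open>j\<close>, so the extreme position
        \<open>j\<close> is a left-to-right maximum.\<close>
      have "lrmax v b"
      proof (cases "b = j")
        case True
        then have "j < d" using abcd by simp
        then have "\<not> rlmin v j" using d(3) unfolding rlmin_def by (meson less_asym)
        then show ?thesis using True jext by simp
      qed (use b in simp)
      from no'[OF abcd a(2) this c(2) d(2)] show ?thesis unfolding wa wd .
    qed
  qed
qed

lemma shallow_no_extreme_3412: "v \<in> shallow_perms n \<Longrightarrow> no_extreme_3412 v"
proof (induction n arbitrary: v)
  case 0
  then show ?case by (auto simp: shallow_perms_0 no_extreme_3412_def)
next
  case (Suc n)
  then show ?case
    unfolding shallow_perms_Suc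
    by (auto intro!: no_extreme_3412_transpose simp: shallow_perms_def)
qed

section \<open>Blocks, and the statistics of the children\<close>

text \<open>These are the places where \<open>v\<close> splits as a direct sum. \<open>0\<close> is
  one of them but is left out of \<open>block_ends\<close>, whose size is therefore the number of
  blocks.\<close>

definition block_end :: "(nat \<Rightarrow> nat) \<Rightarrow> nat \<Rightarrow> bool" where
  "block_end v i \<longleftrightarrow> (\<forall>a\<le>i. v a \<le> i)"

definition block_ends :: "nat \<Rightarrow> (nat \<Rightarrow> nat) \<Rightarrow> nat set" where
  "block_ends n v = {i \<in> {1..n}. block_end v i}"

lemma finite_block_ends [simp]: "finite (block_ends n v)"
  by (simp add: block_ends_def)

text \<open>
  One less than the number of extreme positions of \<open>v \<circ> transpose j (Suc n)\<close>.
\<close>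

definition label :: "nat \<Rightarrow> (nat \<Rightarrow> nat) \<Rightarrow> nat \<Rightarrow> nat" where
  "label n v j = Suc (card {i \<in> {1..n}. lrmax v i \<and> i < j \<or> rlmin v i \<and> v i < v j})"

text \<open>For a bound \<open>N < n\<close>, \<open>extremes N v\<close> collects the extreme
  positions of the whole of \<open>v\<close> up to \<open>N\<close>. Partial counts thus grow one
  position at a time, and so do those of block ends.\<close>

lemma card_extremes_Suc:
  "card (extremes (Suc n) v) = card (extremes n v) + (if lrmax v (Suc n) \<or> rlmin v (Suc n) then 1 else 0)"
proof -
  have "extremes (Suc n) v = (if lrmax v (Suc n) \<or> rlmin v (Suc n) then insert (Suc n) (extremes n v) else extremes n v)"
    by (auto simp: extremes_def le_Suc_eq)
  then show ?thesis by (simp add: extremes_def)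
qed

lemma card_block_ends_Suc:
  "card (block_ends (Suc n) v) = card (block_ends n v) + (if block_end v (Suc n) then 1 else 0)"
proof -
  have "block_ends (Suc n) v = (if block_end v (Suc n) then insert (Suc n) (block_ends n v) else block_ends n v)"
    by (auto simp: block_ends_def le_Suc_eq)
  then show ?thesis by (simp add: block_ends_def)
qed

lemma permutes_block_end_ge: "v permutes {1..n} \<Longrightarrow> n \<le> i \<Longrightarrow> block_end v i"
  unfolding block_end_def
proof (intro allI impI)
  fix a assume "v permutes {1..n}" "n \<le> i" "a \<le> i"
  then show "v a \<le> i" using permutes_le[of v n a] permutes_gt[of v n a] by (cases "a \<le> n") auto
qed

lemma card_extremes_Suc_fixed:
  assumes "v permutes {1..n}"
  shows "card (extremes (Suc n) v) = Suc (card (extremes n v))"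
proof -
  have "lrmax v (Suc n)"
    unfolding lrmax_def using permutes_le[OF assms] permutes_gt[OF assms, of "Suc n"]
    by (simp add: less_Suc_eq_le)
  then show ?thesis by (simp add: card_extremes_Suc)
qed

lemma card_block_ends_Suc_fixed: "v permutes {1..n} \<Longrightarrow> card (block_ends (Suc n) v) = Suc (card (block_ends n v))"
  using permutes_block_end_ge[of v n "Suc n"] by (simp add: card_block_ends_Suc)

text \<open>Positions \<open>j\<close> and \<open>Suc n\<close> are always extreme in the child. One
  of them is kept out of \<open>label\<close> because the child fixing \<open>Suc n\<close> also
  gains one extreme position: all children then share a factor \<open>z\<close>.\<close>

lemma card_extremes_Suc_transpose:
  assumes v: "v permutes {1..n}" and j: "j \<in> {1..n}"
  shows "card (extremes (Suc n) (v \<circ> transpose j (Suc n))) = Suc (label n v j)"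
proof -
  let ?w = "v \<circ> transpose j (Suc n)"
  let ?X = "{i \<in> {1..n}. lrmax v i \<and> i < j \<or> rlmin v i \<and> v i < v j}"
  have "i \<in> extremes (Suc n) ?w \<longleftrightarrow> i \<in> insert j (insert (Suc n) ?X)" for i
    using lrmax_transpose_iff[OF v j, of i] rlmin_transpose_iff[OF v j, of i] j
    unfolding extremes_def by (cases "i \<le> Suc n") auto
  then have "extremes (Suc n) ?w = insert j (insert (Suc n) ?X)" by blast
  moreover have "card (insert j (insert (Suc n) ?X)) = Suc (Suc (card ?X))"
    using j by (subst card_insert_disjoint; auto)+
  ultimately show ?thesis unfolding label_def by (simp only:)
qed

text \<open>Blocks ending before \<open>j\<close> survive. The entry \<open>Suc n\<close> at
  \<open>j\<close> joins everything behind them into one last block.\<close>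

lemma card_block_ends_Suc_transpose:
  assumes v: "v permutes {1..n}" and j: "j \<in> {1..n}"
  shows "card (block_ends (Suc n) (v \<circ> transpose j (Suc n))) = Suc (card (block_ends (j - 1) v))"
proof -
  let ?w = "v \<circ> transpose j (Suc n)"
  have w: "?w j = Suc n" by (simp add: permutes_gt[OF v])
  have cut_w: "block_end ?w i \<longleftrightarrow> i < j \<and> block_end v i" if "i \<le> n" for i
  proof (cases "i < j")
    case True
    then have "?w a = v a" if "a \<le> i" for a using that j by auto
    then show ?thesis using True by (auto simp: block_end_def)
  next
    case False
    then have "\<not> block_end ?w i" unfolding block_end_def using w that by (metis Suc_n_not_le_n le_trans not_less)
    then show ?thesis using False by simp
  qed
  have "block_end ?w (Suc n)" by (rule permutes_block_end_ge[OF permutes_Suc_transpose[OF v j]]) simp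
  then have "i \<in> block_ends (Suc n) ?w \<longleftrightarrow> i \<in> insert (Suc n) (block_ends (j - 1) v)" for i
    using cut_w[of i] j unfolding block_ends_def by (cases "i \<le> n"; cases "i = Suc n") auto
  then have "block_ends (Suc n) ?w = insert (Suc n) (block_ends (j - 1) v)" by blast
  moreover have "Suc n \<notin> block_ends (j - 1) v" using j by (auto simp: block_ends_def)
  ultimately show ?thesis by simp
qed

text \<open>\<open>v\<close> maps \<open>{..N}\<close> bijectively onto \<open>{..c}\<close>, so
  both sets have the same size. With an entry for \<open>c\<close>, this is how block ends are
  detected.\<close>

lemma permutes_threshold:
  assumes v: "v permutes {1..n::nat}" and "\<And>a. a \<le> N \<Longrightarrow> v a \<le> c" "\<And>a. N < a \<Longrightarrow> c < v a"
  shows "c = N"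
proof -
  have "v ` {..N} = {..c}"
  proof (intro equalityI subsetI)
    fix y assume "y \<in> {..c}"
    then have "inv v y \<le> N" using assms(3)[of "inv v y"]
      by (metis atMost_iff linorder_not_less permutes_inverses(1) v)
    then show "y \<in> v ` {..N}"
      by (intro image_eqI[of _ _ "inv v y"]) (simp_all add: permutes_inverses[OF v])
  qed (use assms(2) in auto)
  moreover have "card (v ` {..N}) = card {..N}"
    using permutes_inj_on[OF v] by (rule card_image)
  ultimately show ?thesis by simp
qed

text \<open>An injective map of the finite set \<open>{..N}\<close> into itself is onto, so no value
  up to \<open>N\<close> is left for \<open>a\<close>.\<close>

lemma block_end_gt:
  assumes v: "v permutes {1..n}" and "block_end v N" "N < a"
  shows "N < v a"
proof -
  have "v ` {..N} = {..N}"
    using assms(2) permutes_inj_on[OF v, of "{..N}"]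
    by (intro endo_inj_surj) (auto simp: block_end_def)
  then show ?thesis using assms(3) inj_permutes_eq[OF v]
    by (metis atMost_iff imageE linorder_not_less)
qed

lemma block_end_0: "v permutes {1..n} \<Longrightarrow> block_end v 0"
  using permutes_0[of v n] by (simp add: block_end_def)

lemma lrmax_after_block_end:
  assumes "v permutes {1..n}" "block_end v N"
  shows "lrmax v (Suc N)"
  unfolding lrmax_def
proof (intro allI impI)
  fix i assume "i < Suc N"
  then have "v i \<le> N" using assms(2) by (simp add: block_end_def)
  then show "v i < v (Suc N)" using block_end_gt[OF assms, of "Suc N"] by simp
qed

lemma rlmin_at_block_end:
  assumes "v permutes {1..n}" "block_end v N"
  shows "rlmin v N"
  unfolding rlmin_def
proof (intro allI impI)
  fix i assume "N < i"
  then have "N < v i" by (rule block_end_gt[OF assms])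
  moreover have "v N \<le> N" using assms(2) by (simp add: block_end_def)
  ultimately show "v N < v i" by simp
qed

text \<open>Consequently a block of more than one position does not end in a left-to-right
  maximum.\<close>

lemma block_end_before_lrmax_block_end:
  assumes "block_end v (Suc N)" "lrmax v (Suc N)"
  shows "block_end v N"
  unfolding block_end_def
proof (intro allI impI)
  fix a assume "a \<le> N"
  then have "v a < v (Suc N)" using assms(2) by (simp add: lrmax_def)
  moreover have "v (Suc N) \<le> Suc N" using assms(1) by (simp add: block_end_def)
  ultimately show "v a \<le> N" by simp
qed

text \<open>The entry separates the smaller ones on its left from the greater ones on its right, so
  it is a fixed point and a block by itself.\<close>

lemma block_end_before_lrmax_rlmin:
  assumes v: "v permutes {1..n}" and "lrmax v (Suc N)" "rlmin v (Suc N)"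
  shows "block_end v N"
proof -
  have "v (Suc N) = Suc N"
    using assms(2,3) by (intro permutes_threshold[OF v]) (auto simp: lrmax_def rlmin_def le_Suc_eq less_imp_le)
  then show ?thesis using assms(2) by (auto simp: block_end_def lrmax_def less_Suc_eq_le)
qed

lemma no_lrmax_le:
  assumes "lrmax v M" "\<And>i. M < i \<Longrightarrow> i \<le> N \<Longrightarrow> \<not> lrmax v i" "i \<le> N"
  shows "v i \<le> v M"
  using assms(3)
proof (induction i rule: less_induct)
  case (less i)
  consider "i < M" | "i = M" | "M < i" by linarith
  then show ?case
  proof cases
    case 1
    then show ?thesis using assms(1) by (auto simp: lrmax_def intro: less_imp_le)
  next
    case 3
    then obtain k where "k < i" "v i \<le> v k"
      using assms(2)[of i] less.prems by (auto simp: lrmax_def linorder_not_less)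
    then show ?thesis using less.IH[of k] less.prems by simp
  qed simp
qed

section \<open>Labels as partial counts of extreme positions\<close>

text \<open>Right-to-left minima increase, so those below \<open>v j\<close> are those before
  \<open>j\<close>. The \<open>Suc\<close> in \<open>label\<close> accounts for
  \<open>j\<close>.\<close>

lemma label_rlmin:
  assumes j: "j \<in> {1..n}" "rlmin v j"
  shows "label n v j = card (extremes j v)"
proof -
  have "v i < v j \<longleftrightarrow> i < j" if "rlmin v i" for i
    by (cases i j rule: linorder_cases) (use that j(2) in \<open>auto simp: rlmin_def intro: less_imp_not_less\<close>)
  then have "{i \<in> {1..n}. lrmax v i \<and> i < j \<or> rlmin v i \<and> v i < v j} = extremes (j - 1) v"
    using j(1) by (auto simp: extremes_def)
  then show ?thesis using card_extremes_Suc[of "j - 1" v] j by (simp add: label_def)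
qed

text \<open>Left-to-right maxima increase, so those before \<open>j\<close> are those below
  \<open>v j\<close>, and the whole count is by value.\<close>

lemma label_lrmax:
  assumes v: "v permutes {1..n}" and j: "j \<in> {1..n}" "lrmax v j"
  shows "label n v j = card {i \<in> extremes n v. v i \<le> v j}"
proof -
  have "v i < v j \<longleftrightarrow> i < j" if "lrmax v i" for i
    by (cases i j rule: linorder_cases) (use that j(2) in \<open>auto simp: lrmax_def intro: less_imp_not_less\<close>)
  moreover have "v i \<le> v j \<longleftrightarrow> v i < v j \<or> i = j" for i
    using inj_permutes_eq[OF v] by (metis le_less)
  ultimately have "{i \<in> extremes n v. v i \<le> v j} =
      insert j {i \<in> {1..n}. lrmax v i \<and> i < j \<or> rlmin v i \<and> v i < v j}"
    using j by (auto simp: extremes_def)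
  then show ?thesis by (simp add: label_def)
qed

text \<open>\<open>v M\<close> is the greatest entry up to the block end \<open>p\<close>, so
  \<open>v M = p\<close>, and counting by value agrees with counting by position.\<close>

lemma label_lrmax_block_end:
  assumes v: "v permutes {1..n}" and M: "M \<in> {1..p}" "lrmax v M" "\<And>i. M < i \<Longrightarrow> i \<le> p \<Longrightarrow> \<not> lrmax v i"
    and p: "p \<le> n" "block_end v p"
  shows "label n v M = card (extremes p v)"
proof -
  have "v M \<le> p" using p M by (auto simp: block_end_def)
  then have "v M = p"
    using block_end_gt[OF v p(2)] no_lrmax_le[OF M(2,3)]
    by (intro permutes_threshold[OF v]) (auto intro: le_less_trans)
  then have "v i \<le> v M \<longleftrightarrow> i \<le> p" for i
    using block_end_gt[OF v p(2), of i] p(2) unfolding block_end_def by (metis linorder_not_less)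
  then have "{i \<in> extremes n v. v i \<le> v M} = extremes p v"
    using p(1) by (auto simp: extremes_def)
  then show ?thesis using label_lrmax[OF v _ M(2)] M p by simp
qed

text \<open>
  The entries below \<open>v M\<close> are those before the next left-to-right maximum, except that the latter
  is traded for the one right-to-left minimum \<open>q\<close> behind it that is smaller than \<open>v M\<close>: it exists
  since no block ends at \<open>N\<close>, and is unique by avoidance of 3412.
\<close>

lemma label_lrmax_next:
  assumes v: "v permutes {1..n}" and no: "no_extreme_3412 v"
    and M: "M \<in> {1..N}" "lrmax v M" "\<And>i. M < i \<Longrightarrow> i \<le> N \<Longrightarrow> \<not> lrmax v i"
    and N: "Suc N \<le> n" "lrmax v (Suc N)" "\<not> block_end v N"
  shows "label n v M = card (extremes (Suc N) v)"
proof -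
  have inj: "v a = v b \<longleftrightarrow> a = b" for a b by (rule inj_permutes_eq[OF v])
  have le_M: "v i \<le> v M" if "i \<le> N" for i using no_lrmax_le[OF M(2,3) that] .
  \<comment> \<open>\<open>q\<close> is the position of the least entry behind
    \<open>N\<close>.\<close>
  define q where "q = inv v (LEAST y. y \<in> v ` {Suc N..})"
  have "(LEAST y. y \<in> v ` {Suc N..}) \<in> v ` {Suc N..}"
    by (rule LeastI[of _ "v (Suc N)"]) auto
  then obtain k where k: "k \<ge> Suc N" "v k = (LEAST y. y \<in> v ` {Suc N..})" by auto
  have qk: "q = k" unfolding q_def by (simp add: permutes_inverses[OF v] flip: k(2))
  have min: "v q \<le> v i" if "i \<ge> Suc N" for i
    unfolding qk k(2) by (rule Least_le) (use that in auto)
  have rl_q: "rlmin v q"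
    unfolding rlmin_def
  proof (intro allI impI)
    fix i assume "q < i"
    then show "v q < v i" using min[of i] inj[of q i] qk k(1) by auto
  qed
  have "\<not> rlmin v (Suc N)" using block_end_before_lrmax_rlmin[OF v N(2)] N(3) by blast
  then have q_gt: "Suc N < q" using qk k(1) rl_q by (metis le_less)
  have "v q \<le> v M"
  proof (rule ccontr)
    assume "\<not> v q \<le> v M"
    then have "v M < v a" if "N < a" for a using min[of a] that by simp
    then have "v M = N" using le_M by (intro permutes_threshold[OF v])
    then show False using le_M N(3) by (simp add: block_end_def)
  qed
  then have vq: "v q < v M" using q_gt M inj[of q M] by auto
  have q_le: "q \<le> n"
    using vq permutes_gt[OF v, of q] permutes_le[OF v, of M] M(1) N(1) by (cases "q \<le> n") auto
  have uniq: "i = q" if "rlmin v i" "Suc N < i" "v i < v M" for i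
  proof (rule ccontr)
    \<comment> \<open>\<open>M\<close> and \<open>Suc N\<close> serve as the two left-to-right
      maxima of the excluded pattern.\<close>
    have no': "v M \<le> v d" if "Suc N < c" "c < d" "rlmin v c" "rlmin v d" for c d
      using no that M N unfolding no_extreme_3412_def by (metis atLeastAtMost_iff le_imp_less_Suc)
    assume "i \<noteq> q"
    then consider "i < q" | "q < i" by linarith
    then show False
      using no'[of i q] no'[of q i] that rl_q q_gt vq by cases auto
  qed
  have lr: "v i \<le> v M \<longleftrightarrow> i \<le> M" if "lrmax v i" for i
    by (cases i M rule: linorder_cases) (use that M(2) in \<open>auto simp: lrmax_def not_le intro: less_imp_le\<close>)
  have "i \<in> extremes n v \<and> v i \<le> v M \<longleftrightarrow> i \<in> insert q (extremes N v)" for i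
  proof (cases "i \<le> N")
    case True
    then show ?thesis using le_M[of i] N(1) q_gt by (auto simp: extremes_def)
  next
    case False
    have "i \<in> extremes n v \<and> v i \<le> v M \<longleftrightarrow> i = q"
    proof
      assume *: "i \<in> extremes n v \<and> v i \<le> v M"
      then have "\<not> lrmax v i" using lr[of i] False M(1) by auto
      then have "rlmin v i" using * by (auto simp: extremes_def)
      moreover have "i \<noteq> Suc N" using \<open>\<not> lrmax v i\<close> N(2) by auto
      moreover have "v i < v M" using * False M(1) inj[of i M] by auto
      ultimately show "i = q" using uniq False by auto
    next
      assume "i = q"
      then show "i \<in> extremes n v \<and> v i \<le> v M"
        using rl_q q_gt q_le vq by (auto simp: extremes_def)
    qed
    then show ?thesis using False by (auto simp: extremes_def)
  qed
  then have "{i \<in> extremes n v. v i \<le> v M} = insert q (extremes N v)" by blast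
  moreover have "q \<notin> extremes N v" using q_gt by (auto simp: extremes_def)
  ultimately have "card {i \<in> extremes n v. v i \<le> v M} = Suc (card (extremes N v))" by simp
  then show ?thesis using label_lrmax[OF v _ M(2)] M N card_extremes_Suc[of N v] by simp
qed

lemma last_lrmax_exists:
  assumes "v permutes {1..n}" "1 \<le> N"
  obtains M where "M \<in> {1..N}" "lrmax v M" "\<And>i. M < i \<Longrightarrow> i \<le> N \<Longrightarrow> \<not> lrmax v i"
proof -
  let ?X = "{i \<in> {1..N}. lrmax v i}"
  have "Suc 0 \<in> ?X" using lrmax_after_block_end[OF assms(1) block_end_0[OF assms(1)]] assms(2) by simp
  then have "Max ?X \<in> ?X" by (intro Max_in) auto
  moreover have "\<not> lrmax v i" if "Max ?X < i" "i \<le> N" for i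
  proof
    assume "lrmax v i"
    then have "i \<in> ?X" using that by auto
    then have "i \<le> Max ?X" by (intro Max_ge) auto
    then show False using that by simp
  qed
  ultimately show ?thesis using that[of "Max ?X"] by blast
qed

text \<open>
  A right-to-left minimum is charged to its own position, a left-to-right maximum to the next one or,
  if it is the last in its block, to the end of the block. The partial sum up to a position then
  depends only on the number of blocks and of extreme positions so far and on whether a block is open.
\<close>

lemma sum_extremes_weights:
  fixes z \<tau> :: "'a::comm_ring_1"
  assumes v: "v permutes {1..n}" and no: "no_extreme_3412 v" and \<tau>: "\<tau> * z ^ 2 = 2 * z - 1"
  shows "(z - 1) * (\<Sum>j\<in>extremes n v. \<tau> ^ card (block_ends (j - 1) v) * z ^ label n v j) =
    z ^ 2 * (\<tau> ^ card (block_ends n v) * z ^ card (extremes n v) - 1)"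
proof -
  define W where "W j = \<tau> ^ card (block_ends (j - 1) v) * z ^ label n v j" for j
  define S where "S N = (\<Sum>j\<in>extremes N v. W j)" for N
  define P where "P N = \<tau> ^ card (block_ends N v) * z ^ card (extremes N v)" for N
  define last_lr where "last_lr N M \<longleftrightarrow> M \<in> {1..N} \<and> lrmax v M \<and> (\<forall>i. M < i \<longrightarrow> i \<le> N \<longrightarrow> \<not> lrmax v i)" for N M
  have S_Suc: "S (Suc N) = S N + (if lrmax v (Suc N) \<or> rlmin v (Suc N) then W (Suc N) else 0)" for N
  proof -
    have "extremes (Suc N) v = (if lrmax v (Suc N) \<or> rlmin v (Suc N)
        then insert (Suc N) (extremes N v) else extremes N v)" "Suc N \<notin> extremes N v"
      by (auto simp: extremes_def le_Suc_eq)
    then show ?thesis by (simp add: S_def add.commute)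
  qed
  have P_Suc: "P (Suc N) = P N * (if block_end v (Suc N) then \<tau> else 1) *
      (if lrmax v (Suc N) \<or> rlmin v (Suc N) then z else 1)" for N
    by (simp add: P_def card_block_ends_Suc card_extremes_Suc)
  \<comment> \<open>A block end from \<open>M\<close> on and before \<open>N\<close> would be
    followed by another left-to-right maximum up to \<open>N\<close>.\<close>
  have block_ends_eq: "card (block_ends (M - 1) v) = card (block_ends N v)"
    if "last_lr N M" "\<not> block_end v N" for N M
  proof -
    have nc: "\<not> block_end v i" if "M \<le> i" "i \<le> N" for i
      using lrmax_after_block_end[OF v, of i] \<open>last_lr N M\<close> \<open>\<not> block_end v N\<close> that
      unfolding last_lr_def by (metis Suc_leI le_imp_less_Suc le_neq_implies_less)
    have "M \<in> {1..N}" using \<open>last_lr N M\<close> by (simp add: last_lr_def)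
    then have "i \<in> block_ends N v \<longleftrightarrow> i \<in> block_ends (M - 1) v" for i
      using nc[of i] unfolding block_ends_def by (cases "i < M") auto
    then have "block_ends N v = block_ends (M - 1) v" by blast
    then show ?thesis by simp
  qed
  \<comment> \<open>At a block end all extreme positions so far have been charged. Inside a block
    the last left-to-right maximum \<open>M\<close> has not, hence the subtracted
    \<open>W M\<close>.\<close>
  have "(block_end v N \<longrightarrow> (z - 1) * S N = z ^ 2 * (P N - 1)) \<and>
    (\<not> block_end v N \<longrightarrow> (\<forall>M. last_lr N M \<longrightarrow> (z - 1) * (S N - W M) = z * P N - z ^ 2))" if "N \<le> n" for N
    using that
  proof (induction N)
    case 0
    then show ?case using block_end_0[OF v] by (simp add: S_def P_def block_ends_def extremes_def)
  next
    case (Suc N)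
    let ?p = "Suc N"
    have p: "?p \<in> {1..n}" and N: "N \<le> n" using Suc.prems by auto
    note IH = Suc.IH[OF N]
    have W_rlmin: "W ?p = P N * z" if "rlmin v ?p"
      using label_rlmin[OF p that] that by (simp add: W_def P_def card_extremes_Suc mult.assoc)
    show ?case
    proof (cases "block_end v N")
      case True
      then have lr: "lrmax v ?p" by (rule lrmax_after_block_end[OF v])
      have IH': "(z - 1) * S N = z ^ 2 * (P N - 1)" using IH True by simp
      show ?thesis
      proof (cases "block_end v ?p")
        case True
        then have "W ?p = P N * z" using W_rlmin rlmin_at_block_end[OF v] by blast
        then have "(z - 1) * S ?p = z ^ 2 * (P N - 1) + (z - 1) * (P N * z)"
          using IH' lr by (simp add: S_Suc distrib_left)
        also have "\<dots> = P N * z * (2 * z - 1) - z ^ 2"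
          by (simp add: algebra_simps power2_eq_square)
        \<comment> \<open>The relation for \<open>\<tau>\<close> serves only where a block closes:
          here for a block of one position, below for a longer one.\<close>
        also have "\<dots> = z ^ 2 * (P ?p - 1)"
          unfolding \<tau>[symmetric] using True lr by (simp add: P_Suc algebra_simps power2_eq_square)
        finally show ?thesis using True by simp
      next
        case False
        have "(z - 1) * (S ?p - W M) = z * P ?p - z ^ 2" if "last_lr ?p M" for M
        proof -
          have "M = ?p" using that lr unfolding last_lr_def by (metis atLeastAtMost_iff le_neq_implies_less order_refl)
          then have "(z - 1) * (S ?p - W M) = z ^ 2 * (P N - 1)"
            using lr by (simp add: S_Suc flip: IH')
          also have "\<dots> = z * P ?p - z ^ 2"
            using lr False by (simp add: P_Suc algebra_simps power2_eq_square)
          finally show ?thesis .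
        qed
        then show ?thesis using False by simp
      qed
    next
      case False
      then have IH': "(z - 1) * (S N - W M) = z * P N - z ^ 2" if "last_lr N M" for M
        using IH that by simp
      have "N \<noteq> 0" using False block_end_0[OF v] by (cases "N = 0") auto
      then obtain M where M: "last_lr N M"
        using last_lrmax_exists[OF v, of N] unfolding last_lr_def by (metis One_nat_def Suc_leI neq0_conv)
      show ?thesis
      proof (cases "lrmax v ?p")
        case True
        then have ncut: "\<not> block_end v ?p" using block_end_before_lrmax_block_end False by blast
        have "label n v M = card (extremes ?p v)"
          using M Suc.prems True False unfolding last_lr_def by (intro label_lrmax_next[OF v no]) auto
        then have WM: "W M = P N * z"
          using block_ends_eq[OF M False] True by (simp add: W_def P_def card_extremes_Suc mult.assoc)
        have "(z - 1) * (S ?p - W M') = z * P ?p - z ^ 2" if "last_lr ?p M'" for M'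
        proof -
          have "M' = ?p" using that True unfolding last_lr_def by (metis atLeastAtMost_iff le_neq_implies_less order_refl)
          then have "(z - 1) * (S ?p - W M') = (z - 1) * (S N - W M) + (z - 1) * W M"
            using True by (simp add: S_Suc algebra_simps)
          also have "\<dots> = z * P ?p - z ^ 2"
            unfolding IH'[OF M] unfolding WM using True ncut by (simp add: P_Suc algebra_simps power2_eq_square)
          finally show ?thesis .
        qed
        then show ?thesis using ncut by simp
      next
        case nlr: False
        have last_lr_Suc: "last_lr ?p M' \<longleftrightarrow> last_lr N M'" for M'
          using nlr unfolding last_lr_def by (auto simp: le_Suc_eq)
        show ?thesis
        proof (cases "block_end v ?p")
          case True
          then have rl: "rlmin v ?p" by (rule rlmin_at_block_end[OF v])
          \<comment> \<open>The closing position carries two charges of weight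
            \<open>P N * z\<close>: its own as a right-to-left minimum and that of
            \<open>M\<close>.\<close>
          have "label n v M = card (extremes ?p v)"
            using M last_lr_Suc[of M] True Suc.prems unfolding last_lr_def by (intro label_lrmax_block_end[OF v]) auto
          then have WM: "W M = P N * z"
            using block_ends_eq[OF M False] rl by (simp add: W_def P_def card_extremes_Suc mult.assoc)
          have "(z - 1) * S ?p = (z - 1) * (S N - W M) + (z - 1) * (W M + W ?p)"
            using rl by (simp add: S_Suc algebra_simps)
          also have "\<dots> = P N * z * (2 * z - 1) - z ^ 2"
            unfolding IH'[OF M] unfolding WM W_rlmin[OF rl] by (simp add: algebra_simps power2_eq_square)
          also have "\<dots> = z ^ 2 * (P ?p - 1)"
            unfolding \<tau>[symmetric] using True rl by (simp add: P_Suc algebra_simps power2_eq_square)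
          finally show ?thesis using True by simp
        next
          case ncut: False
          have "(z - 1) * (S ?p - W M') = z * P ?p - z ^ 2" if "last_lr ?p M'" for M'
          proof (cases "rlmin v ?p")
            case True
            have "(z - 1) * (S ?p - W M') = (z - 1) * (S N - W M') + (z - 1) * W ?p"
              using True by (simp add: S_Suc algebra_simps)
            also have "\<dots> = z * P ?p - z ^ 2"
              using IH'[of M'] that last_lr_Suc W_rlmin True ncut nlr
              by (simp add: P_Suc algebra_simps power2_eq_square)
            finally show ?thesis .
          next
            case False
            then show ?thesis using IH'[of M'] that last_lr_Suc ncut nlr by (simp add: S_Suc P_Suc)
          qed
          then show ?thesis using ncut by simp
        qed
      qed
    qed
  qed
  from this[of n] show ?thesis
    using permutes_block_end_ge[OF v order_refl] by (simp add: S_def P_def W_def)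
qed

section \<open>The generating function\<close>

text \<open>The equation says that substituting \<open>y\<close> into the series \<open>R\<close>
  gives \<open>fps_X\<close>. As \<open>R\<close> has constant term 0 and linear coefficient 1, its
  compositional inverse exists.\<close>

lemma fps_uniformizer_exists:
  "\<exists>y :: 'a::field fps. fps_nth y 0 = 0 \<and> fps_X * ((1 + 2 * y) * (1 + 3 * y + y ^ 2)) = y * (1 + y)"
proof -
  \<comment> \<open>The coefficients are spelled out as repeated sums, over which composition
    distributes.\<close>
  define D :: "'a fps" where "D = (1 + (fps_X + fps_X)) * (1 + (fps_X + (fps_X + fps_X)) + fps_X * fps_X)"
  define R where "R = fps_X * (1 + fps_X) * inverse D"
  define y where "y = fps_inv R"
  have D0: "fps_nth D 0 = 1" by (simp add: D_def)
  then have "fps_nth R 0 = 0" "fps_nth R 1 = 1" by (simp_all add: R_def mult.assoc)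
  then have Ry: "R oo y = fps_X" unfolding y_def by (intro fps_inv_right) auto
  have y0: "fps_nth y 0 = 0" by (simp add: y_def fps_inv_def)
  have "R * D = fps_X * (1 + fps_X)"
    using D0 by (simp add: R_def mult.assoc inverse_mult_eq_1)
  then have "(R * D) oo y = (fps_X * (1 + fps_X)) oo y" by simp
  then have "fps_X * (D oo y) = y * (1 + y)"
    using y0 Ry by (simp add: fps_compose_mult_distrib fps_compose_add_distrib)
  moreover have "D oo y = (1 + 2 * y) * (1 + 3 * y + y ^ 2)"
    using y0 by (simp add: D_def fps_compose_mult_distrib fps_compose_add_distrib power2_eq_square)
  ultimately show ?thesis using y0 by auto
qed

lemma shallow_gf_parametrization:
  fixes y :: "'a::field_char_0 fps"
  assumes y0: "fps_nth y 0 = 0" and y: "fps_X * ((1 + 2 * y) * (1 + 3 * y + y ^ 2)) = y * (1 + y)"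
  shows "Abs_fps (\<lambda>n. of_nat (card (shallow_perms n))) * (1 + y) ^ 2 = 1 + 3 * y + y ^ 2"
proof -
  define z where "z = 1 + y"
  define zi where "zi = inverse z"
  define \<tau> where "\<tau> = (2 * z - 1) * zi ^ 2"
  define G where "G = 1 + y * zi ^ 2"
  have zi: "z * zi = 1" unfolding zi_def by (rule inverse_mult_eq_1') (simp add: z_def y0)
  then have zi2: "zi ^ 2 * z ^ 2 = 1" by (metis mult.commute power_mult_distrib power_one)
  have \<tau>: "\<tau> * z ^ 2 = 2 * z - 1" by (simp add: \<tau>_def mult.assoc zi2)
  have Gz: "G * z ^ 2 = 1 + 3 * y + y ^ 2"
    using zi2 by (simp add: G_def distrib_right mult.assoc) (simp add: z_def power2_eq_square algebra_simps)
  have "fps_X * G * (2 * z - 1) * z = fps_X * ((1 + 2 * y) * (G * z ^ 2)) * zi"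
  proof -
    have "fps_X * G * (2 * z - 1) * z = fps_X * G * (2 * z - 1) * z * (z * zi)" by (simp add: zi)
    then show ?thesis by (simp add: z_def power2_eq_square algebra_simps)
  qed
  also have "\<dots> = y * (z * zi)" unfolding Gz y by (simp add: z_def mult.assoc)
  finally have H: "fps_X * G * (2 * z - 1) * z = y" by (simp add: zi)
  \<comment> \<open>\<open>G\<close> and \<open>\<tau>\<close> are chosen so that this factor,
    common to all children, cancels the \<open>z ^ 2\<close> from
    \<open>sum_extremes_weights\<close>.\<close>
  then have H': "fps_X * G * \<tau> * z = y * zi ^ 2" by (simp add: \<tau>_def mult_ac)
  define wt where "wt n v = G * (\<tau> ^ card (block_ends n v) * z ^ card (extremes n v))" for n v
  \<comment> \<open>The recursion for counting descendants by depth: the node itself, and one factor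
    \<open>fps_X\<close> per generation.\<close>
  have wt_rec: "wt n v = 1 + fps_X * (wt (Suc n) v + (\<Sum>j\<in>extremes n v. wt (Suc n) (v \<circ> transpose j (Suc n))))"
    if "v \<in> shallow_perms n" for n v
  proof -
    have v: "v permutes {1..n}" using that by (simp add: shallow_perms_def)
    define P where "P = \<tau> ^ card (block_ends n v) * z ^ card (extremes n v)"
    define S where "S = (\<Sum>j\<in>extremes n v. \<tau> ^ card (block_ends (j - 1) v) * z ^ label n v j)"
    have yS: "y * S = z ^ 2 * (P - 1)"
      using sum_extremes_weights[OF v shallow_no_extreme_3412[OF that] \<tau>]
      by (simp add: S_def P_def z_def)
    have "wt (Suc n) v = G * \<tau> * z * P"
      by (simp add: wt_def P_def card_block_ends_Suc_fixed[OF v] card_extremes_Suc_fixed[OF v] mult_ac)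
    moreover have "(\<Sum>j\<in>extremes n v. wt (Suc n) (v \<circ> transpose j (Suc n))) = G * \<tau> * z * S"
      unfolding S_def sum_distrib_left
    proof (intro sum.cong refl)
      fix j assume "j \<in> extremes n v"
      then have j: "j \<in> {1..n}" by (simp add: extremes_def)
      show "wt (Suc n) (v \<circ> transpose j (Suc n)) =
          G * \<tau> * z * (\<tau> ^ card (block_ends (j - 1) v) * z ^ label n v j)"
        unfolding wt_def card_block_ends_Suc_transpose[OF v j] card_extremes_Suc_transpose[OF v j]
        by (simp add: mult_ac)
    qed
    ultimately have "1 + fps_X * (wt (Suc n) v + (\<Sum>j\<in>extremes n v. wt (Suc n) (v \<circ> transpose j (Suc n)))) =
        1 + (fps_X * G * \<tau> * z) * (P + S)"
      by (simp add: algebra_simps)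
    also have "\<dots> = 1 + zi ^ 2 * (y * P + y * S)"
      unfolding H' by (simp add: algebra_simps)
    also have "\<dots> = 1 + zi ^ 2 * y * P + (zi ^ 2 * z ^ 2) * (P - 1)"
      unfolding yS by (simp add: algebra_simps)
    also have "\<dots> = G * P" unfolding zi2 by (simp add: G_def algebra_simps)
    finally show ?thesis by (simp add: wt_def P_def)
  qed
  define A where "A n = (\<Sum>v\<in>shallow_perms n. wt n v)" for n
  have A_rec: "A n = of_nat (card (shallow_perms n)) + fps_X * A (Suc n)" for n
    unfolding A_def sum_shallow_perms_Suc
    by (simp add: wt_rec sum.distrib flip: sum_distrib_left)
  \<comment> \<open>Each use of \<open>A_rec\<close> peels off one coefficient, so the recursion
    alone determines the series.\<close>
  have A_nth: "fps_nth (A k) n = of_nat (card (shallow_perms (k + n)))" for k n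
    by (induction n arbitrary: k; subst A_rec) (simp_all add: fps_of_nat[symmetric])
  \<comment> \<open>The root is the identity on the empty set, with neither blocks nor extreme
    positions.\<close>
  have "A 0 = G"
    by (simp add: A_def shallow_perms_0 wt_def block_ends_def extremes_def)
  then have "G = Abs_fps (\<lambda>n. of_nat (card (shallow_perms n)))"
    using A_nth[of 0] by (intro fps_ext) simp
  then show ?thesis using Gz by (simp add: z_def)
qed

text \<open>In terms of \<open>u = fps_X * G\<close> and \<open>G - 1\<close>, the cubic multiplied
  by \<open>(c * z ^ 2) ^ 2\<close> involves only \<open>u * c * z\<close> and
  \<open>(G - 1) * z ^ 2\<close> besides \<open>c\<close> and \<open>z\<close>. Both products equal
  \<open>y\<close>, which leaves a polynomial identity in \<open>y\<close>.\<close>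

lemma cubic_equation:
  fixes y G :: "'a::field_char_0 fps"
  assumes y0: "fps_nth y 0 = 0" and y: "fps_X * ((1 + 2 * y) * (1 + 3 * y + y ^ 2)) = y * (1 + y)"
    and G: "G * (1 + y) ^ 2 = 1 + 3 * y + y ^ 2"
  shows "fps_X ^ 2 * G ^ 3 + (fps_X ^ 2 - 3 * fps_X + 1) * G ^ 2 + (3 * fps_X - 2) * G + 1 = 0"
proof -
  define c where "c = 1 + 2 * y"
  define z where "z = 1 + y"
  define u where "u = fps_X * G"
  have nz: "z \<noteq> 0" "c \<noteq> 0" using y0 by (auto simp: z_def c_def dest!: arg_cong[of _ 0 "\<lambda>f. fps_nth f 0"])
  have "(u * c * z) * z = fps_X * (c * (G * z ^ 2))" by (simp add: u_def power2_eq_square mult_ac)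
  also have "\<dots> = y * z" using y G by (simp add: c_def z_def)
  finally have u: "u * c * z = y" using nz by simp
  have H: "(G - 1) * z ^ 2 = y"
    using G by (simp add: z_def algebra_simps power2_eq_square)
  have "(c * z ^ 2) ^ 2 * (u ^ 2 * (G - 1 + 2) - 3 * u * (G - 1) + (G - 1) ^ 2) =
      (u * c * z) ^ 2 * ((G - 1) * z ^ 2 + 2 * z ^ 2) - 3 * (u * c * z) * ((G - 1) * z ^ 2) * c * z
      + ((G - 1) * z ^ 2) ^ 2 * c ^ 2"
    by (simp add: algebra_simps power2_eq_square)
  also have "\<dots> = 0"
    unfolding u H by (simp add: c_def z_def algebra_simps power2_eq_square)
  finally have "u ^ 2 * (G - 1 + 2) - 3 * u * (G - 1) + (G - 1) ^ 2 = 0"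
    using nz by simp
  then show ?thesis
    by (simp add: u_def algebra_simps power2_eq_square power3_eq_cube)
qed

section \<open>Transfer from rational to integer coefficients\<close>

text \<open>The series \<open>y\<close> is constructed over a field. This coefficientwise ring
  homomorphism, injective in characteristic 0, brings the equation back to integer series.\<close>

definition fps_of_int_coeffs :: "int fps \<Rightarrow> 'a::ring_1 fps" where
  "fps_of_int_coeffs f = Abs_fps (\<lambda>n. of_int (fps_nth f n))"

lemma fps_of_int_coeffs_nth [simp]: "fps_nth (fps_of_int_coeffs f) n = of_int (fps_nth f n)"
  by (simp add: fps_of_int_coeffs_def)

lemma fps_of_int_coeffs_simps [simp]:
  "fps_of_int_coeffs (f + g) = fps_of_int_coeffs f + fps_of_int_coeffs g"
  "fps_of_int_coeffs (f - g) = fps_of_int_coeffs f - fps_of_int_coeffs g"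
  "fps_of_int_coeffs (f * g) = fps_of_int_coeffs f * fps_of_int_coeffs g"
  "fps_of_int_coeffs 0 = 0" "fps_of_int_coeffs 1 = 1" "fps_of_int_coeffs fps_X = fps_X"
  "fps_of_int_coeffs (numeral k) = numeral k"
  by (auto simp: fps_eq_iff fps_mult_nth fps_X_def fps_numeral_nth)

lemma fps_of_int_coeffs_power [simp]: "fps_of_int_coeffs (f ^ k) = fps_of_int_coeffs f ^ k"
  by (induction k) simp_all

lemma fps_of_int_coeffs_eq_0_iff [simp]:
  "fps_of_int_coeffs f = (0 :: 'a::ring_char_0 fps) \<longleftrightarrow> f = 0"
  by (simp add: fps_eq_iff)

theorem corollary1p2:
  shows "fps_X ^ 2 * shallow_gf ^ 3 + (fps_X ^ 2 - 3 * fps_X + 1) * shallow_gf ^ 2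
           + (3 * fps_X - 2) * shallow_gf + 1 = 0" (is "?lhs = 0")
proof -
  obtain y :: "rat fps" where y: "fps_nth y 0 = 0"
    "fps_X * ((1 + 2 * y) * (1 + 3 * y + y ^ 2)) = y * (1 + y)"
    using fps_uniformizer_exists by blast
  have "fps_of_int_coeffs shallow_gf = Abs_fps (\<lambda>n. of_nat (card (shallow_perms n)) :: rat)"
    by (simp add: fps_of_int_coeffs_def shallow_gf_def)
  then have "fps_of_int_coeffs ?lhs = (0 :: rat fps)"
    using cubic_equation[OF y shallow_gf_parametrization[OF y]] by simp
  then show ?thesis by (simp only: fps_of_int_coeffs_eq_0_iff)
qed

end
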